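(* Let $G$ be a finite group. Then $s(G)=1-\dfrac{1}{|G|}$.
   Context: Sofic dimension of a countable discrete group $G$ with identity $e$ (the specialization to groups of the sofic dimension of a p.m.p. groupoid). Put $I_G=G\cup\{0\}\subseteq\mathbb{C}[G]$, with $g^*=g^{-1}$ for $g\in G$ and $0^*=0$. Let $\tau$ be the canonical trace: $\tau(e)=1$, $\tau(g)=0$ for $g\in G\setminus\{e\}$, $\tau(0)=0$. For $\Omega\subseteq I_G$ let $\Omega^*=\{s^*:s\in\Omega\}$, let $\Omega^k$ be the set of products $s_1\cdots s_k$ with $s_i\in\Omega$, and let $\Omega^{\le n}=\bigcup_{k=1}^n\Omega^k$. Let $I_d$ be the set of partial permutation matrices in $M_d=M_d(\mathbb{C})$ (partial isometries with all entries $0$ or $1$), $\mathrm{tr}$ the normalized trace on $M_d$, and $\|a\|_2=\mathrm{tr}(a^*a)^{1/2}$. For a finite $F\subseteq I_G$, $n,d\in\mathbb{N}$, $\delta>0$, $\mathrm{SA}(F,n,\delta,d)$ is the set of all linear maps $\varphi:\mathbb{C}[G]\to M_d$ such that (1) $\|\varphi(s_1\cdots s_k)-\varphi(s_1)\cdots\varphi(s_k)\|_2<\delta$ for all $k=1,\dots,n$ and $s_1,\dots,s_k\in F\cup F^*$, (2) $\varphi((F\cup F^* )^{\le n})\subseteq I_d$, (3) $|\mathrm{tr}(\varphi(s))-\tau(s)|<\delta$ for all $s\in(F\cup F^* )^{\le n}$. For a set $\mathcal{Y}$ of maps, $|\mathcal{Y}|_E$ is the cardinality of the set of restrictions $\{\varphi|_E:\varphi\in\mathcal{Y}\}$.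 For finite $E,F\subseteq I_G$ set $s_E(F,n,\delta)=\limsup_{d\to\infty}\frac{1}{d\log d}\log|\mathrm{SA}(F,n,\delta,d)|_E$ (with $\log 0=-\infty$) and $s_E(F)=\inf_{n\in\mathbb{N}}\inf_{\delta>0}s_E(F,n,\delta)$. The sofic dimension is $s(G)=\sup_E\inf_F s_E(F)$, where $E$ and $F$ range over the finite subsets of $I_G$. *)

theory Defs
  imports "HOL-Library.Extended_Real" "HOL-Library.FuncSet" "Jordan_Normal_Form.Schur_Decomposition"
begin

section \<open>The group algebra\<close>

text \<open>Elements of $C[G]$ are finitely supported functions, extended by 0 outside the carrier;
  the product is convolution.\<close>

definition group_algebra :: "('a, 'm) monoid_scheme \<Rightarrow> (complex, 'a \<Rightarrow> complex) module" where
  "group_algebra G = \<lparr>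
     carrier = {f. finite {x. f x \<noteq> 0} \<and> {x. f x \<noteq> 0} \<subseteq> carrier G},
     monoid.mult = (\<lambda>f g x. if x \<in> carrier G
                     then (\<Sum>y | y \<in> carrier G \<and> f y \<noteq> 0. f y * g (inv\<^bsub>G\<^esub> y \<otimes>\<^bsub>G\<^esub> x)) else 0),
     one = (\<lambda>x. if x = \<one>\<^bsub>G\<^esub> then 1 else 0),
     zero = (\<lambda>x. 0),
     add = (\<lambda>f g x. f x + g x),
     module.smult = (\<lambda>c f x. c * f x) \<rparr>"

definition group_elt :: "'a \<Rightarrow> 'a \<Rightarrow> complex" where
  "group_elt g = (\<lambda>x. if x = g then 1 else 0)"

definition I_group :: "('a, 'm) monoid_scheme \<Rightarrow> ('a \<Rightarrow> complex) set" where
  "I_group G = insert \<zero>\<^bsub>group_algebra G\<^esub> (group_elt ` carrier G)"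

text \<open>The involution and the canonical trace are given on all of $C[G]$; the lemmas at the end
  of this section compute them on \<open>I_group G\<close>, which is the only place where they are used.\<close>

definition ga_star :: "('a, 'm) monoid_scheme \<Rightarrow> ('a \<Rightarrow> complex) \<Rightarrow> 'a \<Rightarrow> complex" where
  "ga_star G f = (\<lambda>x. if x \<in> carrier G then cnj (f (inv\<^bsub>G\<^esub> x)) else 0)"

definition ga_trace :: "('a, 'm) monoid_scheme \<Rightarrow> ('a \<Rightarrow> complex) \<Rightarrow> complex" where
  "ga_trace G f = f \<one>\<^bsub>G\<^esub>"

definition ga_prod :: "('a, 'm) monoid_scheme \<Rightarrow> ('a \<Rightarrow> complex) list \<Rightarrow> 'a \<Rightarrow> complex" where
  "ga_prod G ss = foldr (\<lambda>s t. s \<otimes>\<^bsub>group_algebra G\<^esub> t) ss \<one>\<^bsub>group_algebra G\<^esub>"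

definition powers_upto ::
    "('a, 'm) monoid_scheme \<Rightarrow> ('a \<Rightarrow> complex) set \<Rightarrow> nat \<Rightarrow> ('a \<Rightarrow> complex) set" where
  "powers_upto G \<Omega> n = (\<Union>k\<in>{1..n}. {ga_prod G ss | ss. length ss = k \<and> set ss \<subseteq> \<Omega>})"

lemma ga_star_group_elt:
  assumes "group G" "g \<in> carrier G"
  shows "ga_star G (group_elt g) = group_elt (inv\<^bsub>G\<^esub> g)"
proof -
  interpret group G by fact
  show ?thesis
    using assms(2) by (auto simp: ga_star_def group_elt_def fun_eq_iff)
qed

lemma ga_star_zero: "ga_star G \<zero>\<^bsub>group_algebra G\<^esub> = \<zero>\<^bsub>group_algebra G\<^esub>"
  by (auto simp: ga_star_def group_algebra_def)

lemma ga_trace_group_elt: "ga_trace G (group_elt g) = (if g = \<one>\<^bsub>G\<^esub> then 1 else 0)"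
  by (simp add: ga_trace_def group_elt_def)

lemma ga_trace_zero: "ga_trace G \<zero>\<^bsub>group_algebra G\<^esub> = 0"
  by (simp add: ga_trace_def group_algebra_def)

lemma ga_mult_group_elt:
  assumes "group G" "g \<in> carrier G" "h \<in> carrier G"
  shows "group_elt g \<otimes>\<^bsub>group_algebra G\<^esub> group_elt h = group_elt (g \<otimes>\<^bsub>G\<^esub> h)"
proof -
  interpret group G by fact
  have "{y \<in> carrier G. group_elt g y \<noteq> 0} = {g}"
    using assms(2) by (auto simp: group_elt_def)
  moreover have "inv\<^bsub>G\<^esub> g \<otimes>\<^bsub>G\<^esub> x = h \<longleftrightarrow> x = g \<otimes>\<^bsub>G\<^esub> h" if "x \<in> carrier G" for x
    using assms(2,3) that by (metis inv_solve_left)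
  ultimately show ?thesis
    using assms(2,3) by (auto simp: group_algebra_def fun_eq_iff) (auto simp: group_elt_def)
qed

lemma ga_mult_zero:
  "f \<otimes>\<^bsub>group_algebra G\<^esub> \<zero>\<^bsub>group_algebra G\<^esub> = \<zero>\<^bsub>group_algebra G\<^esub>"
  "\<zero>\<^bsub>group_algebra G\<^esub> \<otimes>\<^bsub>group_algebra G\<^esub> f = \<zero>\<^bsub>group_algebra G\<^esub>"
  by (auto simp: group_algebra_def)


section \<open>Matrices\<close>

definition norm_trace :: "complex mat \<Rightarrow> complex" where
  "norm_trace A = (\<Sum>i<dim_row A. A $$ (i, i)) / of_nat (dim_row A)"

definition norm2 :: "complex mat \<Rightarrow> real" where
  "norm2 A = sqrt (Re (norm_trace (mat_adjoint A * A)))"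

definition partial_isometry :: "complex mat \<Rightarrow> bool" where
  "partial_isometry A \<longleftrightarrow> A * mat_adjoint A * A = A"

definition partial_perm_mats :: "nat \<Rightarrow> complex mat set" where
  "partial_perm_mats d =
     {A \<in> carrier_mat d d. partial_isometry A \<and> (\<forall>i<d. \<forall>j<d. A $$ (i, j) \<in> {0, 1})}"

definition mat_list_prod :: "nat \<Rightarrow> complex mat list \<Rightarrow> complex mat" where
  "mat_list_prod d As = foldr (*) As (1\<^sub>m d)"


section \<open>Sofic dimension\<close>

definition linear_maps ::
    "('a, 'm) monoid_scheme \<Rightarrow> nat \<Rightarrow> (('a \<Rightarrow> complex) \<Rightarrow> complex mat) set" where
  "linear_maps G d = {\<phi> \<in> carrier (group_algebra G) \<rightarrow>\<^sub>E carrier_mat d d.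
     (\<forall>x\<in>carrier (group_algebra G). \<forall>y\<in>carrier (group_algebra G).
        \<phi> (x \<oplus>\<^bsub>group_algebra G\<^esub> y) = \<phi> x + \<phi> y) \<and>
     (\<forall>c. \<forall>x\<in>carrier (group_algebra G). \<phi> (c \<odot>\<^bsub>group_algebra G\<^esub> x) = c \<cdot>\<^sub>m \<phi> x)}"

definition SA :: "('a, 'm) monoid_scheme \<Rightarrow> ('a \<Rightarrow> complex) set \<Rightarrow> nat \<Rightarrow> real \<Rightarrow> nat
    \<Rightarrow> (('a \<Rightarrow> complex) \<Rightarrow> complex mat) set" where
  "SA G F n \<delta> d = (let \<Omega> = F \<union> ga_star G ` F in {\<phi> \<in> linear_maps G d.
     (\<forall>k\<in>{1..n}. \<forall>ss. length ss = k \<and> set ss \<subseteq> \<Omega> \<longrightarrow>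
        norm2 (\<phi> (ga_prod G ss) - mat_list_prod d (map \<phi> ss)) < \<delta>) \<and>
     \<phi> ` powers_upto G \<Omega> n \<subseteq> partial_perm_mats d \<and>
     (\<forall>s\<in>powers_upto G \<Omega> n. cmod (norm_trace (\<phi> s) - ga_trace G s) < \<delta>)})"

text \<open>\<open>card\<close> is 0 on infinite sets, whereas infinitely many restrictions do occur when \<open>E\<close> is not
  covered by the products of elements of \<open>F\<close>; the logarithm of an infinite cardinality
  is \<open>\<infinity>\<close>.\<close>

definition log_card :: "'x set \<Rightarrow> ereal" where
  "log_card A = (if infinite A then \<infinity> else if A = {} then - \<infinity> else ereal (ln (real (card A))))"

definition sofic_dim_at :: "('a, 'm) monoid_scheme \<Rightarrow> ('a \<Rightarrow> complex) set
    \<Rightarrow> ('a \<Rightarrow> complex) set \<Rightarrow> nat \<Rightarrow> real \<Rightarrow> ereal" where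
  "sofic_dim_at G E F n \<delta> =
     limsup (\<lambda>d. log_card ((\<lambda>\<phi>. restrict \<phi> E) ` SA G F n \<delta> d) / ereal (real d * ln (real d)))"

definition sofic_dim_wrt :: "('a, 'm) monoid_scheme \<Rightarrow> ('a \<Rightarrow> complex) set
    \<Rightarrow> ('a \<Rightarrow> complex) set \<Rightarrow> ereal" where
  "sofic_dim_wrt G E F = (INF n\<in>{1..}. INF \<delta>\<in>{0<..}. sofic_dim_at G E F n \<delta>)"

definition sofic_dimension :: "('a, 'm) monoid_scheme \<Rightarrow> ereal" where
  "sofic_dimension G = (SUP E\<in>{E. finite E \<and> E \<subseteq> I_group G}.
     INF F\<in>{F. finite F \<and> F \<subseteq> I_group G}. sofic_dim_wrt G E F)"

end

theory Submission
  imports Defs "HOL-Real_Asymp.Real_Asymp" "HOL-Combinatorics.Permutations"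
begin

text \<open>
  Write \<open>m\<close> for the order of \<open>G\<close>. A sofic approximation of degree \<open>d\<close> is, up to a few exceptional
  points, a free action of \<open>G\<close> on \<open>d\<close> points, so the theorem comes down to counting such actions.
  A free action is pinned down by a set of orbit representatives, which has at most \<open>d / m\<close> points,
  together with the images of each representative under the \<open>m - 1\<close> non-identity elements. Choosing
  the set costs only a factor \<open>2 ^ d\<close>, which is negligible on the scale \<open>d * ln d\<close>, while the images
  cost about \<open>d ^ ((m - 1) * d / m)\<close>. The exponent is \<open>1 - 1 / m\<close>.

  Partial permutation matrices are coded as functions on the natural numbers with an extra null
  point \<open>d\<close>, so that a family of such matrices becomes a family of functions \<open>a g\<close>, the matrix product
  becomes composition, the 2-norm distance bounds the number of disagreements, and the
  normalized trace counts fixed points. The points at which \<open>a\<close> fails to be a free action are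
  its \<open>defects\<close>.

  For the upper bound take \<open>F\<close> to be all of \<open>I_group G\<close> and \<open>n = 2\<close>. Then each map in \<open>SA\<close> has at
  most a constant times \<open>\<delta> * d\<close> defects (\<open>almost_action_of_SA\<close>). The remaining points are permuted
  freely by \<open>G\<close>, so the count above applies to them, and on the defects nothing is known, which
  costs an arbitrarily small multiple of \<open>d * ln d\<close> (\<open>card_almost_actions_le\<close>).

  For the lower bound consider degrees \<open>d = m * q\<close> and genuine free actions. Their permutation
  representations lie in \<open>SA\<close> for all parameters (\<open>permutation_rep_in_SA\<close>), and there are at least
  \<open>q! ^ (m - 1)\<close> of them (\<open>card_free_actions_ge\<close>), which has the same growth rate. Degrees that
  are not multiples of \<open>m\<close> can be ignored because of the limit superior.
\<close>


section \<open>Partial permutation matrices as maps with a null point\<close>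

text \<open>A partial map of \<open>{..<d}\<close> to itself, with \<open>d\<close> playing the role of ``undefined''. Making
  every map total and fixing the null point lets composition of partial maps be ordinary
  composition.\<close>
definition null_maps :: "nat \<Rightarrow> (nat \<Rightarrow> nat) set" where
  "null_maps d = {c. (\<forall>j<d. c j \<le> d) \<and> (\<forall>j\<ge>d. c j = d)}"

text \<open>Column \<open>j\<close> is the unit vector of index \<open>c j\<close>, or zero if \<open>c j\<close> is the null point.\<close>
definition map_mat :: "nat \<Rightarrow> (nat \<Rightarrow> nat) \<Rightarrow> complex mat" where
  "map_mat d c = mat d d (\<lambda>(i, j). if c j = i then 1 else 0)"

lemma map_mat_carrier [simp]: "map_mat d c \<in> carrier_mat d d"
  by (simp add: map_mat_def)

lemma dim_map_mat [simp]: "dim_row (map_mat d c) = d" "dim_col (map_mat d c) = d"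
  by (simp_all add: map_mat_def)

lemma map_mat_index [simp]:
  "i < d \<Longrightarrow> j < d \<Longrightarrow> map_mat d c $$ (i, j) = (if c j = i then 1 else 0)"
  by (simp add: map_mat_def)

lemma null_maps_le: "c \<in> null_maps d \<Longrightarrow> c j \<le> d"
  by (cases "j < d") (auto simp: null_maps_def)

lemma null_maps_null: "c \<in> null_maps d \<Longrightarrow> d \<le> j \<Longrightarrow> c j = d"
  by (simp add: null_maps_def)

lemma inj_on_map_mat: "inj_on (map_mat d) (null_maps d)"
proof (intro inj_onI ext)
  fix a b j
  assume ab: "a \<in> null_maps d" "b \<in> null_maps d" "map_mat d a = map_mat d b"
  have eq: "(a j = i) = (b j = i)" if "i < d" "j < d" for i
    using arg_cong[OF ab(3), of "\<lambda>M. M $$ (i, j)"] that by (simp split: if_splits)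
  show "a j = b j"
  proof (cases "j < d")
    case True
    then show ?thesis
      using eq[of "a j"] eq[of "b j"] null_maps_le[OF ab(1), of j] null_maps_le[OF ab(2), of j]
      by force
  next
    case False
    then show ?thesis
      using ab by (simp add: null_maps_null)
  qed
qed

lemma null_maps_comp:
  assumes "a \<in> null_maps d" "b \<in> null_maps d"
  shows "a \<circ> b \<in> null_maps d"
proof -
  have "(a \<circ> b) j \<le> d" for j
    using null_maps_le[OF assms(1)] by simp
  moreover have "(a \<circ> b) j = d" if "d \<le> j" for j
    using null_maps_null[OF assms(2) that] null_maps_null[OF assms(1)] by simp
  ultimately show ?thesis
    unfolding null_maps_def by blast
qed

lemma map_mat_mult:
  assumes "a \<in> null_maps d" "b \<in> null_maps d"
  shows "map_mat d a * map_mat d b = map_mat d (a \<circ> b)"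
proof (rule eq_matI)
  fix i j assume ij: "i < dim_row (map_mat d (a \<circ> b))" "j < dim_col (map_mat d (a \<circ> b))"
  then have "(map_mat d a * map_mat d b) $$ (i, j)
      = (\<Sum>k = 0..<d. (if a k = i then 1 else 0) * (if b j = k then 1 else 0))"
    by (simp add: scalar_prod_def)
  also have "\<dots> = (\<Sum>k\<in>{0..<d}. if k = b j then (if a k = i then 1 else 0) else 0)"
    by (intro sum.cong) auto
  also have "\<dots> = (if b j < d \<and> a (b j) = i then 1 else 0)"
    by (simp add: sum.delta)
  also have "\<dots> = map_mat d (a \<circ> b) $$ (i, j)"
    using ij null_maps_null[OF assms(1), of "b j"] by auto
  finally show "(map_mat d a * map_mat d b) $$ (i, j) = map_mat d (a \<circ> b) $$ (i, j)" .
qed auto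

lemma mat_adjoint_index:
  "i < dim_col A \<Longrightarrow> j < dim_row A \<Longrightarrow> mat_adjoint A $$ (i, j) = conjugate (A $$ (j, i))"
  by (simp add: mat_adjoint_def mat_of_rows_index)

lemma dim_mat_adjoint [simp]:
  "dim_row (mat_adjoint A) = dim_col A" "dim_col (mat_adjoint A) = dim_row A"
  by (simp_all add: mat_adjoint_def)

text \<open>All entries are 0 or 1, so entry \<open>(i, j)\<close> of \<open>A * mat_adjoint A * A\<close> counts the zigzag paths of
  ones from row \<open>i\<close> to column \<open>j\<close>. A second one in column \<open>j\<close> would produce a second path, whereas
  for a partial isometry the count is the entry 1 itself.\<close>
lemma partial_perm_mat_column:
  assumes A: "A \<in> partial_perm_mats d" and ij: "i < d" "l < d" "j < d"
    and one: "A $$ (i, j) = 1" "A $$ (l, j) = 1"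
  shows "i = l"
proof (rule ccontr)
  assume "i \<noteq> l"
  define r where "r i j = Re (A $$ (i, j))" for i j
  have carr: "A \<in> carrier_mat d d" and ent: "\<And>i j. i < d \<Longrightarrow> j < d \<Longrightarrow> A $$ (i, j) \<in> {0, 1}"
    and pi: "A * mat_adjoint A * A = A"
    using A by (auto simp: partial_perm_mats_def partial_isometry_def)
  have r: "A $$ (i, j) = of_real (r i j)" "r i j \<ge> 0" if "i < d" "j < d" for i j
    using ent[OF that] by (auto simp: r_def)
  have "A $$ (i, j) = (A * mat_adjoint A * A) $$ (i, j)"
    by (simp add: pi)
  also have "\<dots> = (\<Sum>p = 0..<d. (\<Sum>k = 0..<d. A $$ (i, k) * conjugate (A $$ (p, k))) * A $$ (p, j))"
    using carr ij by (auto simp: scalar_prod_def mat_adjoint_index intro!: sum.cong)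
  also have "\<dots> = of_real (\<Sum>p = 0..<d. (\<Sum>k = 0..<d. r i k * r p k) * r p j)"
    using ij by (simp add: r)
  finally have eq: "r i j = (\<Sum>p = 0..<d. (\<Sum>k = 0..<d. r i k * r p k) * r p j)"
    by (subst (asm) r(1)[OF ij(1,3)]) (simp only: of_real_eq_iff)
  have rr: "r i j = 1" "r l j = 1"
    using one by (simp_all add: r_def)
  have ge: "(\<Sum>k = 0..<d. r i k * r p k) * r p j \<ge> 1" if "p < d" "r p j = 1" for p
  proof -
    have "r i j * r p j \<le> (\<Sum>k = 0..<d. r i k * r p k)"
      using ij that by (intro member_le_sum) (auto intro!: mult_nonneg_nonneg r)
    then show ?thesis using rr that by simp
  qed
  \<comment> \<open>The rows \<open>i\<close> and \<open>l\<close> contribute at least one path each, so the sum is at least 2.\<close>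
  have "(\<Sum>p\<in>{i, l}. 1) \<le> (\<Sum>p\<in>{i, l}. (\<Sum>k = 0..<d. r i k * r p k) * r p j)"
    using ge[of i] ge[of l] ij rr by (intro sum_mono) auto
  also have "\<dots> \<le> (\<Sum>p = 0..<d. (\<Sum>k = 0..<d. r i k * r p k) * r p j)"
    using ij by (intro sum_mono2) (auto intro!: mult_nonneg_nonneg sum_nonneg r)
  finally show False
    using \<open>i \<noteq> l\<close> eq rr by simp
qed

lemma partial_perm_mat_is_map_mat:
  assumes A: "A \<in> partial_perm_mats d"
  shows "\<exists>c\<in>null_maps d. A = map_mat d c"
proof -
  define c where "c j = (if \<exists>i<d. j < d \<and> A $$ (i, j) = 1
    then (THE i. i < d \<and> A $$ (i, j) = 1) else d)" for j
  have c: "c j = i" if "i < d" "j < d" "A $$ (i, j) = 1" for i j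
  proof -
    have "(THE i. i < d \<and> A $$ (i, j) = 1) = i"
      using partial_perm_mat_column[OF A] that by (intro the_equality) auto
    then show ?thesis using that by (auto simp: c_def)
  qed
  have cd: "c j = d" if "\<not> (\<exists>i<d. j < d \<and> A $$ (i, j) = 1)" for j
    unfolding c_def by (rule if_not_P[OF that])
  have "c \<in> null_maps d"
    unfolding null_maps_def
  proof (intro CollectI conjI allI impI)
    fix j
    show "c j \<le> d"
      using c[of _ j] cd[of j] by (cases "\<exists>i<d. j < d \<and> A $$ (i, j) = 1") auto
    show "c j = d" if "d \<le> j"
      using that by (intro cd) auto
  qed
  moreover have "A = map_mat d c"
  proof (rule eq_matI)
    fix i j assume "i < dim_row (map_mat d c)" "j < dim_col (map_mat d c)"
    then have ij: "i < d" "j < d" by simp_all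
    have "A $$ (i, j) \<in> {0, 1}"
      using A ij by (auto simp: partial_perm_mats_def)
    moreover have "A $$ (i, j) = 1" if "c j = i"
      using cd[of j] c[of _ j] that ij by auto
    ultimately show "A $$ (i, j) = map_mat d c $$ (i, j)"
      using c[OF ij] ij by (auto simp del: dim_map_mat)
  qed (use A in \<open>auto simp: partial_perm_mats_def\<close>)
  ultimately show ?thesis by blast
qed

text \<open>A partial map with a partial inverse \<open>c'\<close>: the adjoint of the matrix of \<open>c\<close> is the matrix of
  \<open>c'\<close>.\<close>
lemma map_mat_partial_perm:
  assumes c: "c \<in> null_maps d" and c': "c' \<in> null_maps d"
    and inv: "\<And>i j. i < d \<Longrightarrow> j < d \<Longrightarrow> c j = i \<longleftrightarrow> c' i = j"
  shows "map_mat d c \<in> partial_perm_mats d"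
proof -
  have adj: "mat_adjoint (map_mat d c) = map_mat d c'"
    by (rule eq_matI) (auto simp: mat_adjoint_index inv)
  have comp: "c \<circ> c' \<in> null_maps d"
    using c c' by (rule null_maps_comp)
  have "c (c' (c j)) = c j" for j
    using inv[of "c j" j] null_maps_le[OF c, of j] null_maps_null[OF c] null_maps_null[OF c']
    by (metis le_neq_implies_less not_le order_refl)
  then have "map_mat d c * map_mat d c' * map_mat d c = map_mat d c"
    using c c' comp by (simp add: map_mat_mult comp_def)
  then show ?thesis
    by (simp add: partial_perm_mats_def partial_isometry_def adj)
qed

lemma norm2_eq_sum:
  assumes "A \<in> carrier_mat d d"
  shows "norm2 A = sqrt ((\<Sum>j<d. \<Sum>i<d. (cmod (A $$ (i, j)))\<^sup>2) / real d)"
proof -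
  have "(mat_adjoint A * A) $$ (j, j) = of_real (\<Sum>i<d. (cmod (A $$ (i, j)))\<^sup>2)" if "j < d" for j
    using assms that
    by (auto simp: scalar_prod_def mat_adjoint_index complex_norm_square mult.commute
        lessThan_atLeast0 simp del: of_real_power intro!: sum.cong)
  then have "norm_trace (mat_adjoint A * A)
      = of_real ((\<Sum>j<d. \<Sum>i<d. (cmod (A $$ (i, j)))\<^sup>2) / real d)"
    using assms by (simp add: norm_trace_def)
  then show ?thesis
    unfolding norm2_def by (simp only: Re_complex_of_real)
qed

text \<open>Two columns that differ do so in an entry of modulus 1, so each disagreement contributes at
  least \<open>1 / d\<close> to the squared 2-norm.\<close>
lemma card_disagreement_le_norm2:
  assumes a: "a \<in> null_maps d" and b: "b \<in> null_maps d"
    and small: "norm2 (map_mat d a - map_mat d b) < \<delta>"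
  shows "real (card {j. j < d \<and> a j \<noteq> b j}) \<le> \<delta>\<^sup>2 * real d"
proof (cases "d = 0")
  case False
  define M where "M = map_mat d a - map_mat d b"
  define S where "S = (\<Sum>j<d. \<Sum>i<d. (cmod (M $$ (i, j)))\<^sup>2)"
  have M: "M \<in> carrier_mat d d"
    unfolding M_def by (rule minus_carrier_mat[OF map_mat_carrier])
  have "(1::real) \<le> (\<Sum>i<d. (cmod (M $$ (i, j)))\<^sup>2)" if j: "j < d" "a j \<noteq> b j" for j
  proof -
    obtain i where i: "i < d" "i = a j \<and> i \<noteq> b j \<or> i = b j \<and> i \<noteq> a j"
      using j null_maps_le[OF a, of j] null_maps_le[OF b, of j] by (metis le_neq_implies_less)
    then have "1 = (cmod (M $$ (i, j)))\<^sup>2"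
      using j by (auto simp: M_def)
    also have "\<dots> \<le> (\<Sum>i<d. (cmod (M $$ (i, j)))\<^sup>2)"
      using i by (intro member_le_sum) auto
    finally show ?thesis .
  qed
  then have "(\<Sum>j\<in>{j. j < d \<and> a j \<noteq> b j}. 1)
      \<le> (\<Sum>j\<in>{j. j < d \<and> a j \<noteq> b j}. \<Sum>i<d. (cmod (M $$ (i, j)))\<^sup>2)"
    by (intro sum_mono) auto
  also have "\<dots> \<le> S"
    unfolding S_def by (intro sum_mono2) (auto intro: sum_nonneg)
  finally have "real (card {j. j < d \<and> a j \<noteq> b j}) \<le> S"
    by simp
  moreover have "sqrt (S / real d) < \<delta>"
    using small norm2_eq_sum[OF M] by (simp add: M_def S_def)
  then have "S / real d \<le> \<delta>\<^sup>2"
    by (rule sqrt_le_D[OF less_imp_le])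
  then have "S \<le> \<delta>\<^sup>2 * real d"
    using False by (simp add: field_simps)
  ultimately show ?thesis by linarith
qed auto

lemma norm_trace_map_mat:
  "norm_trace (map_mat d a) = of_real (real (card {j. j < d \<and> a j = j}) / real d)"
proof -
  have "(\<Sum>i<d. if a i = i then 1 else 0 :: complex) = of_nat (card {j. j < d \<and> a j = j})"
    by (simp add: sum.If_cases Collect_conj_eq lessThan_def)
  then show ?thesis
    by (simp add: norm_trace_def)
qed


section \<open>Counting almost free actions\<close>

text \<open>The three parts are the failure to be multiplicative, the failure of the identity to act
  trivially, and the failure to be free. A point moved to the null point is also a defect:
  it cannot be recovered by the inverse element.\<close>
definition defects ::
    "('a, 'm) monoid_scheme \<Rightarrow> nat \<Rightarrow> ('a \<Rightarrow> nat \<Rightarrow> nat) \<Rightarrow> nat set" where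
  "defects G d a =
     (\<Union>(g, h)\<in>carrier G \<times> carrier G. {j. j < d \<and> a g (a h j) \<noteq> a (g \<otimes>\<^bsub>G\<^esub> h) j}) \<union>
     {j. j < d \<and> a \<one>\<^bsub>G\<^esub> j \<noteq> j} \<union>
     (\<Union>g\<in>carrier G - {\<one>\<^bsub>G\<^esub>}. {j. j < d \<and> a g j = j})"

definition almost_actions ::
    "('a, 'm) monoid_scheme \<Rightarrow> nat \<Rightarrow> nat \<Rightarrow> ('a \<Rightarrow> nat \<Rightarrow> nat) set" where
  "almost_actions G d b =
     {a \<in> carrier G \<rightarrow>\<^sub>E null_maps d. card (defects G d a) \<le> b}"

lemma defects_subset: "defects G d a \<subseteq> {..<d}"
  by (auto simp: defects_def)

lemma finite_defects [simp]: "finite (defects G d a)"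
  using defects_subset finite_lessThan by (rule finite_subset)

lemma finite_null_maps [simp]: "finite (null_maps d)"
proof (rule finite_imageD)
  show "inj_on (\<lambda>c. restrict c {..<d}) (null_maps d)"
  proof (intro inj_onI ext)
    fix c c' j
    assume "c \<in> null_maps d" "c' \<in> null_maps d" "restrict c {..<d} = restrict c' {..<d}"
    then show "c j = c' j"
      by (cases "j < d") (auto simp: null_maps_null fun_eq_iff restrict_def split: if_splits)
  qed
  have "(\<lambda>c. restrict c {..<d}) ` null_maps d \<subseteq> {..<d} \<rightarrow>\<^sub>E {..d}"
    by (intro image_subsetI restrict_PiE_iff[THEN iffD2]) (auto simp: null_maps_le)
  then show "finite ((\<lambda>c. restrict c {..<d}) ` null_maps d)"
    by (rule finite_subset) (auto intro: finite_PiE)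
qed

lemma finite_almost_actions:
  "finite (carrier G) \<Longrightarrow> finite (almost_actions G d b)"
  unfolding almost_actions_def
  by (rule finite_subset[OF _ finite_PiE[of "carrier G" "\<lambda>_. null_maps d"]]) simp_all

context group
begin

lemma regular_point:
  assumes "j \<in> {..<d} - defects G d a"
  shows "\<And>g h. g \<in> carrier G \<Longrightarrow> h \<in> carrier G \<Longrightarrow> a g (a h j) = a (g \<otimes> h) j"
    and "a \<one> j = j"
    and "\<And>g. g \<in> carrier G \<Longrightarrow> a g j = j \<Longrightarrow> g = \<one>"
  using assms by (auto simp: defects_def)

text \<open>The points that are not defects form an invariant set: each condition at \<open>a g j\<close> reduces to
  one at \<open>j\<close>, freeness after conjugation by \<open>g\<close>. In particular no null point is reached.\<close>
lemma regular_point_image: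
  assumes a: "a \<in> carrier G \<rightarrow> null_maps d" and j: "j \<in> {..<d} - defects G d a"
    and g: "g \<in> carrier G"
  shows "a g j \<in> {..<d} - defects G d a"
proof -
  note R = regular_point[OF j]
  have "a (inv g) (a g j) = j"
    using R g by simp
  moreover have "a (inv g) d = d"
    using a g by (intro null_maps_null) auto
  ultimately have "a g j \<noteq> d"
    using j by auto
  then have lt: "a g j < d"
    using null_maps_le[of "a g" d j] a g by (auto simp: Pi_iff)
  have "a h (a k (a g j)) = a (h \<otimes> k) (a g j)" if "h \<in> carrier G" "k \<in> carrier G" for h k
    using that g R(1) by (simp add: m_assoc)
  moreover have "a \<one> (a g j) = a g j"
    using g R(1) by simp
  moreover have "k = \<one>" if "k \<in> carrier G" "a k (a g j) = a g j" for k
  proof -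
    have "a (inv g \<otimes> (k \<otimes> g)) j = a (inv g) (a k (a g j))"
      using that(1) g R(1) by simp
    also have "\<dots> = j"
      using that g R(1,2) by simp
    finally have "inv g \<otimes> (k \<otimes> g) = \<one>"
      using that(1) g by (intro R(3)) auto
    then have "k \<otimes> g = g"
      using that(1) g inv_solve_left'[of g "k \<otimes> g" \<one>] by (metis inv_solve_left m_closed one_closed r_one)
    then show "k = \<one>"
      using that(1) g by (metis l_one right_cancel one_closed)
  qed
  ultimately show ?thesis
    using lt by (auto simp: defects_def)
qed

text \<open>The regular points split into free orbits, and the least elements of the orbits represent
  them. Orbits have \<open>card (carrier G)\<close> points each, hence the bound on the number of
  representatives.\<close>
lemma orbit_transversal:
  assumes fin: "finite (carrier G)" and a: "a \<in> carrier G \<rightarrow> null_maps d"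
  shows "\<exists>T \<subseteq> {..<d} - defects G d a. card T * card (carrier G) \<le> d \<and>
    (\<forall>j\<in>{..<d} - defects G d a. \<exists>t\<in>T. \<exists>g\<in>carrier G. j = a g t)"
proof -
  define R where "R = {..<d} - defects G d a"
  define orb where "orb j = (\<lambda>g. a g j) ` carrier G" for j
  define T where "T = (\<lambda>j. Min (orb j)) ` R"
  have act: "a g (a h j) = a (g \<otimes> h) j" if "j \<in> R" "g \<in> carrier G" "h \<in> carrier G" for g h j
    using regular_point(1)[of j d a] that by (simp add: R_def)
  have id: "a \<one> j = j" if "j \<in> R" for j
    using regular_point(2)[of j d a] that by (simp add: R_def)
  have free: "g = \<one>" if "j \<in> R" "g \<in> carrier G" "a g j = j" for j g
    using regular_point(3)[of j d a] that by (simp add: R_def)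
  have closed: "a g j \<in> R" if "j \<in> R" "g \<in> carrier G" for j g
    using regular_point_image[OF a] that by (simp add: R_def)
  have inv_act: "a (inv g) (a g j) = j" if "j \<in> R" "g \<in> carrier G" for j g
    using act[of j "inv g" g] id that by simp
  have sub: "orb (a g j) \<subseteq> orb j" if "j \<in> R" "g \<in> carrier G" for j g
    using act that by (auto simp: orb_def)
  have orb_eq: "orb (a g j) = orb j" if "j \<in> R" "g \<in> carrier G" for j g
    using sub[OF that] sub[of "a g j" "inv g"] inv_act[OF that] closed[OF that] that by auto
  have Min_orb: "\<exists>g\<in>carrier G. Min (orb j) = a g j" for j
  proof -
    have "finite (orb j)" "orb j \<noteq> {}"
      using fin one_closed by (auto simp: orb_def)
    then have "Min (orb j) \<in> orb j" by (rule Min_in)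
    then show ?thesis unfolding orb_def by blast
  qed
  have TR: "T \<subseteq> R"
  proof
    fix t assume "t \<in> T"
    then obtain j where j: "j \<in> R" "t = Min (orb j)"
      by (auto simp: T_def)
    moreover obtain g where "g \<in> carrier G" "Min (orb j) = a g j"
      using Min_orb by blast
    ultimately show "t \<in> R"
      using closed by simp
  qed
  have T_min: "t = Min (orb t)" if t: "t \<in> T" for t
  proof -
    obtain j where j: "j \<in> R" "t = Min (orb j)"
      using t by (auto simp: T_def)
    moreover obtain g where "g \<in> carrier G" "Min (orb j) = a g j"
      using Min_orb by blast
    ultimately have "orb t = orb j"
      using orb_eq by simp
    then show ?thesis
      using j by simp
  qed
  have cover: "\<exists>t\<in>T. \<exists>g\<in>carrier G. j = a g t" if "j \<in> R" for j
  proof -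
    obtain g where g: "g \<in> carrier G" "Min (orb j) = a g j"
      using Min_orb by blast
    then have "j = a (inv g) (Min (orb j))"
      using inv_act[OF that] by simp
    moreover have "Min (orb j) \<in> T" "inv g \<in> carrier G"
      using g that unfolding T_def by blast+
    ultimately show ?thesis by blast
  qed
  have inj: "inj_on (\<lambda>(t, g). a g t) (T \<times> carrier G)"
  proof (rule inj_onI, clarify)
    fix t g t' h
    assume t: "t \<in> T" "t' \<in> T" and gh: "g \<in> carrier G" "h \<in> carrier G" and eq: "a g t = a h t'"
    have R: "t \<in> R" "t' \<in> R"
      using t TR by auto
    have "t = t'"
    proof -
      have "orb t = orb t'"
        using orb_eq[OF R(1) gh(1)] orb_eq[OF R(2) gh(2)] eq by simp
      then show ?thesis
        using T_min[OF t(1)] T_min[OF t(2)] by simp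
    qed
    moreover have "inv h \<otimes> g = \<one>"
      using inv_act[OF R(2) gh(2)] act[OF R(1), of "inv h" g] eq \<open>t = t'\<close> gh
      by (intro free[OF R(1)]) auto
    then have "g = h"
      using gh by (metis inv_closed inv_equality inv_inv)
    ultimately show "t = t' \<and> g = h" by simp
  qed
  have "card T * card (carrier G) = card (T \<times> carrier G)"
    by (simp add: card_cartesian_product)
  also have "\<dots> \<le> card {..<d}"
    using inj TR closed by (intro card_inj_on_le[of "\<lambda>(t, g). a g t"]) (auto simp: R_def)
  finally have card: "card T * card (carrier G) \<le> d" by simp
  show ?thesis
    unfolding R_def[symmetric] using TR card cover by (intro exI[of _ T] conjI ballI)
qed

text \<open>A regular point has the form \<open>a g t\<close> with \<open>t\<close> in \<open>T\<close>, and there \<open>a h\<close> acts as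
  \<open>a (h \<otimes> g) t\<close>. So the images of \<open>T\<close> determine the action on all regular points.\<close>
lemma almost_actions_determined:
  assumes a: "a \<in> carrier G \<rightarrow>\<^sub>E null_maps d" and a': "a' \<in> carrier G \<rightarrow>\<^sub>E null_maps d"
    and B: "defects G d a = B" "defects G d a' = B"
    and T: "T \<subseteq> {..<d} - B" "\<forall>j\<in>{..<d} - B. \<exists>t\<in>T. \<exists>g\<in>carrier G. j = a g t"
    and eqT: "\<And>g t. g \<in> carrier G - {\<one>} \<Longrightarrow> t \<in> T \<Longrightarrow> a g t = a' g t"
    and eqB: "\<And>g j. g \<in> carrier G \<Longrightarrow> j \<in> B \<Longrightarrow> a g j = a' g j"
  shows "a = a'"
proof (rule PiE_ext[OF a a'], rule ext)
  fix h j assume h: "h \<in> carrier G"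
  have eqT': "a g t = a' g t" if "g \<in> carrier G" "t \<in> T" for g t
    using regular_point(2)[of t d a] regular_point(2)[of t d a'] eqT that T B
    by (cases "g = \<one>") auto
  consider "d \<le> j" | "j \<in> B" | "j \<in> {..<d} - B"
    by fastforce
  then show "a h j = a' h j"
  proof cases
    case 1
    then show ?thesis
      using null_maps_null[OF PiE_mem[OF a h] 1] null_maps_null[OF PiE_mem[OF a' h] 1] by simp
  next
    case 2
    then show ?thesis using eqB h by simp
  next
    case 3
    then obtain t g where t: "t \<in> T" "g \<in> carrier G" "j = a g t"
      using T by blast
    then have reg: "t \<in> {..<d} - defects G d a" "t \<in> {..<d} - defects G d a'"
      using T B by auto
    have "a h j = a (h \<otimes> g) t"
      using regular_point(1)[OF reg(1)] t h by simp
    also have "\<dots> = a' (h \<otimes> g) t"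
      using t h by (intro eqT') auto
    also have "\<dots> = a' h (a' g t)"
      using regular_point(1)[OF reg(2)] t h by simp
    also have "\<dots> = a' h j"
      using eqT' t by simp
    finally show ?thesis .
  qed
qed

text \<open>The factor \<open>4 ^ d\<close> pays for the choice of the transversal \<open>T\<close> and of the set \<open>B\<close> of
  defects. Once these are fixed, there are at most \<open>d + 1\<close> values at each of the
  \<open>(m - 1) * card T + m * card B\<close> places that determine the almost action.\<close>
lemma card_almost_actions_le:
  assumes fin: "finite (carrier G)"
  defines "m \<equiv> card (carrier G)"
  shows "card (almost_actions G d b) \<le> 4 ^ d * (d + 1) ^ ((m - 1) * (d div m) + m * b)"
proof -
  define N where "N = (m - 1) * (d div m) + m * b"
  define X where "X = (\<lambda>(T, B). {a \<in> almost_actions G d b. defects G d a = B \<and>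
    T \<subseteq> {..<d} - B \<and> card T * m \<le> d \<and>
    (\<forall>j\<in>{..<d} - B. \<exists>t\<in>T. \<exists>g\<in>carrier G. j = a g t)})"
  define P where "P = Pow {..<d} \<times> Pow {..<d}"
  have m: "m > 0"
    unfolding m_def using fin one_closed by (auto simp: card_gt_0_iff)
  have cover: "almost_actions G d b \<subseteq> (\<Union>p\<in>P. X p)"
  proof
    fix a assume a: "a \<in> almost_actions G d b"
    then have "a \<in> carrier G \<rightarrow> null_maps d"
      by (auto simp: almost_actions_def)
    from orbit_transversal[OF fin this] obtain T where
      "T \<subseteq> {..<d} - defects G d a" "card T * m \<le> d"
      "\<forall>j\<in>{..<d} - defects G d a. \<exists>t\<in>T. \<exists>g\<in>carrier G. j = a g t"
      unfolding m_def by blast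
    then have "a \<in> X (T, defects G d a)" "(T, defects G d a) \<in> P"
      using a defects_subset[of G d a] by (auto simp: X_def P_def)
    then show "a \<in> (\<Union>p\<in>P. X p)" by blast
  qed
  have X_le: "card (X p) \<le> (d + 1) ^ N" if "p \<in> P" for p
  proof (cases "X p = {}")
    case False
    obtain T B where p: "p = (T, B)" by (cases p)
    have TB: "card T * m \<le> d" "card B \<le> b" "T \<subseteq> {..<d}" "B \<subseteq> {..<d}"
      using False that by (auto simp: p X_def P_def almost_actions_def)
    then have finTB: "finite T" "finite B"
      by (auto intro: finite_subset)
    define D where "D = (carrier G - {\<one>}) \<times> T \<union> carrier G \<times> B"
    define r where "r a = restrict (\<lambda>(g, j). a g j) D" for a :: "'a \<Rightarrow> nat \<Rightarrow> nat"
    have "finite D"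
      using fin finTB by (simp add: D_def)
    have "inj_on r (X p)"
    proof (rule inj_onI)
      fix a a' assume *: "a \<in> X p" "a' \<in> X p" "r a = r a'"
      have eq: "a g j = a' g j" if "(g, j) \<in> D" for g j
        using fun_cong[OF *(3), of "(g, j)"] that by (simp add: r_def)
      show "a = a'"
      proof (rule almost_actions_determined)
        show "a g t = a' g t" if "g \<in> carrier G - {\<one>}" "t \<in> T" for g t
          using eq that by (auto simp: D_def)
        show "a g j = a' g j" if "g \<in> carrier G" "j \<in> B" for g j
          using eq that by (auto simp: D_def)
      qed (use * in \<open>auto simp: X_def p almost_actions_def\<close>)
    qed
    moreover have "r ` X p \<subseteq> D \<rightarrow>\<^sub>E {..d}"
    proof
      fix f assume "f \<in> r ` X p"
      then obtain a where a: "a \<in> carrier G \<rightarrow>\<^sub>E null_maps d" "f = r a"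
        by (auto simp: X_def p almost_actions_def)
      then show "f \<in> D \<rightarrow>\<^sub>E {..d}"
        by (auto simp: r_def D_def intro: null_maps_le[OF PiE_mem[OF a(1)]])
    qed
    moreover have "finite (D \<rightarrow>\<^sub>E {..d})"
      using \<open>finite D\<close> by (auto intro: finite_PiE)
    ultimately have "card (X p) \<le> card (D \<rightarrow>\<^sub>E {..d})"
      by (rule card_inj_on_le)
    also have "\<dots> = (d + 1) ^ card D"
      using \<open>finite D\<close> by (simp add: card_PiE)
    also have "\<dots> \<le> (d + 1) ^ N"
    proof (rule power_increasing)
      have "card D \<le> (m - 1) * card T + m * card B"
        unfolding D_def using fin finTB
        by (intro order.trans[OF card_Un_le]) (simp add: card_cartesian_product m_def)
      also have "\<dots> \<le> N"
        using TB m unfolding N_def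
        by (intro add_mono mult_left_mono) (auto simp: less_eq_div_iff_mult_less_eq)
      finally show "card D \<le> N" .
    qed simp
    finally show ?thesis .
  qed auto
  have "finite P" by (simp add: P_def)
  have "card (almost_actions G d b) \<le> card (\<Union>p\<in>P. X p)"
    using cover finite_almost_actions[OF fin, of d b] \<open>finite P\<close>
    by (intro card_mono) (auto simp: X_def)
  also have "\<dots> \<le> (\<Sum>p\<in>P. card (X p))"
    using \<open>finite P\<close> by (rule card_UN_le)
  also have "\<dots> \<le> (\<Sum>p\<in>P. (d + 1) ^ N)"
    by (intro sum_mono X_le)
  also have "\<dots> = 4 ^ d * (d + 1) ^ N"
    by (simp add: P_def card_cartesian_product card_Pow flip: power_mult_distrib)
  finally show ?thesis by (simp add: N_def)
qed

text \<open>A labelling \<open>\<beta> \<sigma>\<close> of the \<open>d\<close> points by pairs \<open>(g, i)\<close> transports left multiplication on the first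
  component to a free action. The labels use one block of \<open>q\<close> points for each \<open>g\<close>, permuted
  by \<open>\<sigma> g\<close>. Leaving the block of the identity unpermuted makes \<open>\<sigma>\<close> recoverable from the action,
  because \<open>g\<close> sends the point labelled \<open>(\<one>, i)\<close> to the one labelled \<open>(g, i)\<close>.\<close>
lemma card_free_actions_ge:
  assumes fin: "finite (carrier G)"
  shows "fact q ^ (card (carrier G) - 1) \<le> card (almost_actions G (card (carrier G) * q) 0)"
proof -
  define m where "m = card (carrier G)"
  define d where "d = m * q"
  obtain \<iota> where \<iota>: "bij_betw \<iota> (carrier G) {..<m}"
    using ex_bij_betw_finite_nat[OF fin] by (auto simp: m_def lessThan_atLeast0)
  define S where "S = (carrier G - {\<one>}) \<rightarrow>\<^sub>E {p. p permutes {..<q}}"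
  define \<beta> where "\<beta> \<sigma> = (\<lambda>(g, i). \<iota> g * q + (if g = \<one> then i else \<sigma> g i))"
    for \<sigma> :: "'a \<Rightarrow> nat \<Rightarrow> nat"
  define pos where "pos \<sigma> = inv_into (carrier G \<times> {..<q}) (\<beta> \<sigma>)" for \<sigma>
  define act where "act \<sigma> = (\<lambda>h\<in>carrier G. \<lambda>j. if j < d
    then \<beta> \<sigma> (h \<otimes> fst (pos \<sigma> j), snd (pos \<sigma> j)) else d)" for \<sigma>
  have \<iota>_lt: "\<iota> g < m" if "g \<in> carrier G" for g
    using \<iota> that by (auto simp: bij_betw_def)
  have lt: "(if g = \<one> then i else \<sigma> g i) < q"
    if "\<sigma> \<in> S" "g \<in> carrier G" "i < q" for \<sigma> g i
    using that permutes_in_image[of "\<sigma> g" "{..<q}" i] by (auto simp: S_def PiE_iff)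
  have \<beta>_lt: "\<beta> \<sigma> (g, i) < d" if "\<sigma> \<in> S" "g \<in> carrier G" "i < q" for \<sigma> g i
  proof -
    have "\<beta> \<sigma> (g, i) < \<iota> g * q + q"
      using lt[OF that] by (simp add: \<beta>_def)
    also have "\<dots> = (\<iota> g + 1) * q" by simp
    also have "\<dots> \<le> m * q"
      using \<iota>_lt[OF that(2)] by (intro mult_right_mono) auto
    finally show ?thesis by (simp add: d_def)
  qed
  have \<beta>_inj: "inj_on (\<beta> \<sigma>) (carrier G \<times> {..<q})" if \<sigma>: "\<sigma> \<in> S" for \<sigma>
  proof (rule inj_onI, clarify)
    fix g i h k
    assume *: "g \<in> carrier G" "i < q" "h \<in> carrier G" "k < q"
      and eq: "\<beta> \<sigma> (g, i) = \<beta> \<sigma> (h, k)"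
    have dm: "\<beta> \<sigma> (g, i) div q = \<iota> g" "\<beta> \<sigma> (g, i) mod q = (if g = \<one> then i else \<sigma> g i)"
      if "g \<in> carrier G" "i < q" for g i
      using lt[OF \<sigma> that] that by (auto simp: \<beta>_def)
    have same: "(if g = \<one> then i else \<sigma> g i) = (if h = \<one> then k else \<sigma> h k)"
      using dm(2)[of g i] dm(2)[of h k] eq * by simp
    have "g = h"
      using dm(1)[of g i] dm(1)[of h k] eq * inj_onD[OF bij_betw_imp_inj_on[OF \<iota>], of g h] by simp
    moreover have "i = k"
    proof (cases "g = \<one>")
      case True
      then show ?thesis
        using same \<open>g = h\<close> by simp
    next
      case False
      then have "\<sigma> g permutes {..<q}"
        using \<sigma> * by (auto simp: S_def PiE_iff)
      moreover have "\<sigma> g i = \<sigma> g k"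
        using same \<open>g = h\<close> False by simp
      ultimately show ?thesis
        by (metis permutes_inverses(2))
    qed
    ultimately show "g = h \<and> i = k" by simp
  qed
  have \<beta>_bij: "bij_betw (\<beta> \<sigma>) (carrier G \<times> {..<q}) {..<d}" if \<sigma>: "\<sigma> \<in> S" for \<sigma>
    unfolding bij_betw_def
  proof
    show "inj_on (\<beta> \<sigma>) (carrier G \<times> {..<q})" by (rule \<beta>_inj[OF \<sigma>])
    show "\<beta> \<sigma> ` (carrier G \<times> {..<q}) = {..<d}"
    proof (rule card_subset_eq)
      show "card (\<beta> \<sigma> ` (carrier G \<times> {..<q})) = card {..<d}"
        using card_image[OF \<beta>_inj[OF \<sigma>]] by (simp add: card_cartesian_product d_def m_def)
    qed (use \<beta>_lt[OF \<sigma>] in auto)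
  qed
  have act_\<beta>: "act \<sigma> h (\<beta> \<sigma> (g, i)) = \<beta> \<sigma> (h \<otimes> g, i)"
    if "\<sigma> \<in> S" "g \<in> carrier G" "h \<in> carrier G" "i < q" for \<sigma> g h i
    using that \<beta>_lt[of \<sigma> g i] inv_into_f_f[OF \<beta>_inj[of \<sigma>], of "(g, i)"]
    by (simp add: act_def pos_def)
  have \<beta>_cases: "\<exists>g i. g \<in> carrier G \<and> i < q \<and> j = \<beta> \<sigma> (g, i)" if "\<sigma> \<in> S" "j < d" for \<sigma> j
  proof -
    have "j \<in> \<beta> \<sigma> ` (carrier G \<times> {..<q})"
      using bij_betw_imp_surj_on[OF \<beta>_bij[OF that(1)]] that(2) by simp
    then show ?thesis by auto
  qed
  have "act \<sigma> \<in> almost_actions G d 0" if \<sigma>: "\<sigma> \<in> S" for \<sigma>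
  proof -
    have "act \<sigma> h \<in> null_maps d" if h: "h \<in> carrier G" for h
    proof -
      have "act \<sigma> h j \<le> d" if "j < d" for j
      proof -
        obtain g i where "g \<in> carrier G" "i < q" "j = \<beta> \<sigma> (g, i)"
          using \<beta>_cases[OF \<sigma> \<open>j < d\<close>] by blast
        then show ?thesis
          using \<beta>_lt[OF \<sigma>, of "h \<otimes> g" i] act_\<beta>[OF \<sigma> _ h] h by simp
      qed
      then show ?thesis
        using h by (auto simp: null_maps_def act_def)
    qed
    moreover have "defects G d (act \<sigma>) = {}"
    proof -
      have "act \<sigma> g (act \<sigma> h j) = act \<sigma> (g \<otimes> h) j"
        if "j < d" "g \<in> carrier G" "h \<in> carrier G" for g h j
        using \<beta>_cases[OF \<sigma> that(1)] that(2,3) by (auto simp: act_\<beta>[OF \<sigma>] m_assoc)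
      moreover have "act \<sigma> \<one> j = j" if "j < d" for j
        using \<beta>_cases[OF \<sigma> that] by (auto simp: act_\<beta>[OF \<sigma>])
      moreover have "g = \<one>" if "j < d" "g \<in> carrier G" "act \<sigma> g j = j" for g j
      proof -
        obtain h i where h: "h \<in> carrier G" "i < q" "j = \<beta> \<sigma> (h, i)"
          using \<beta>_cases[OF \<sigma> \<open>j < d\<close>] by blast
        then have "\<beta> \<sigma> (g \<otimes> h, i) = \<beta> \<sigma> (h, i)"
          using that act_\<beta>[OF \<sigma>] by simp
        then have "g \<otimes> h = h"
          using h that inj_onD[OF \<beta>_inj[OF \<sigma>], of "(g \<otimes> h, i)" "(h, i)"] by simp
        then show "g = \<one>"
          using h that by (metis l_one right_cancel one_closed)
      qed
      ultimately show ?thesis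
        by (auto simp: defects_def)
    qed
    ultimately show ?thesis
      by (auto simp: almost_actions_def act_def)
  qed
  moreover have "inj_on act S"
  proof (rule inj_onI)
    fix \<sigma> \<sigma>' assume \<sigma>: "\<sigma> \<in> S" "\<sigma>' \<in> S" and eq: "act \<sigma> = act \<sigma>'"
    show "\<sigma> = \<sigma>'"
    proof (rule PiE_ext[of _ "carrier G - {\<one>}" "\<lambda>_. {p. p permutes {..<q}}"])
      fix g assume g: "g \<in> carrier G - {\<one>}"
      then have perm: "\<sigma> g permutes {..<q}" "\<sigma>' g permutes {..<q}"
        using \<sigma> by (auto simp: S_def PiE_iff)
      show "\<sigma> g = \<sigma>' g"
      proof
        fix i
        show "\<sigma> g i = \<sigma>' g i"
        proof (cases "i < q")
          case True
          have "\<beta> \<sigma> (\<one>, i) = \<beta> \<sigma>' (\<one>, i)"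
            by (simp add: \<beta>_def)
          then have "\<beta> \<sigma> (g, i) = \<beta> \<sigma>' (g, i)"
            using act_\<beta>[OF \<sigma>(1), of \<one> g i] act_\<beta>[OF \<sigma>(2), of \<one> g i] eq g True by simp
          then show ?thesis
            using g by (simp add: \<beta>_def)
        next
          case False
          then show ?thesis
            using perm by (simp add: permutes_not_in)
        qed
      qed
    qed (use \<sigma> in \<open>simp_all add: S_def\<close>)
  qed
  ultimately have "card S \<le> card (almost_actions G d 0)"
    using finite_almost_actions[OF fin] by (intro card_inj_on_le) auto
  moreover have "card S = fact q ^ (m - 1)"
    using fin by (simp add: S_def card_PiE card_permutations[of "{..<q}" q] m_def)
  ultimately show ?thesis
    by (simp add: d_def m_def)
qed

end


section \<open>Cardinalities and growth rates\<close>

lemma card_UN_le_real: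
  assumes "finite I" "\<And>i. i \<in> I \<Longrightarrow> real (card (A i)) \<le> x"
  shows "real (card (\<Union>i\<in>I. A i)) \<le> real (card I) * x"
proof -
  have "real (card (\<Union>i\<in>I. A i)) \<le> real (\<Sum>i\<in>I. card (A i))"
    using card_UN_le[OF assms(1)] by (simp only: of_nat_le_iff)
  also have "\<dots> = (\<Sum>i\<in>I. real (card (A i)))" by simp
  also have "\<dots> \<le> real (card I) * x"
    using assms(2) by (intro sum_bounded_above) auto
  finally show ?thesis .
qed

lemma log_card_le:
  assumes "finite X" "card X \<le> N"
  shows "log_card X \<le> ereal (ln (real N))"
proof (cases "X = {}")
  case False
  then have "0 < card X"
    using assms by (simp add: card_gt_0_iff)
  then have "ln (real (card X)) \<le> ln (real N)"
    using assms by (intro ln_mono) auto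
  then show ?thesis
    using assms False by (simp add: log_card_def)
qed (simp add: log_card_def)

text \<open>The finiteness of \<open>X\<close> may be assumed, since \<open>log_card\<close> is infinite otherwise.\<close>
lemma log_card_ge:
  assumes "finite X \<Longrightarrow> N \<le> card X" "0 < N"
  shows "ereal (ln (real N)) \<le> log_card X"
proof (cases "finite X")
  case True
  then have "N \<le> card X" by (rule assms(1))
  then have "X \<noteq> {}" using assms(2) by auto
  moreover have "ln (real N) \<le> ln (real (card X))"
    using \<open>N \<le> card X\<close> assms(2) by (intro ln_mono) auto
  ultimately show ?thesis
    using True by (simp add: log_card_def)
qed (simp add: log_card_def)

text \<open>The weak form \<open>q! \<ge> (q / e) ^ q\<close> of Stirling's formula: \<open>q ^ q / q!\<close> is one term of the
  exponential series at \<open>q\<close>.\<close>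
lemma ln_fact_ge:
  shows "real q * ln (real q) - real q \<le> ln (fact q)"
proof (cases "q = 0")
  case False
  have "(\<Sum>n\<in>{q}. real q ^ n /\<^sub>R fact n) \<le> (\<Sum>n. real q ^ n /\<^sub>R fact n)"
    by (intro sum_le_suminf summable_exp_generic) auto
  then have "real q ^ q / fact q \<le> exp (real q)"
    by (simp add: exp_def field_simps)
  then have "ln (real q ^ q / fact q) \<le> ln (exp (real q))"
    using False by (intro ln_mono) auto
  then show ?thesis
    using False by (simp add: ln_div ln_realpow)
qed simp

lemma upper_rate_tendsto:
  "(\<lambda>d. (real d * ln 4 + c * real d * ln (real d + 1)) / (real d * ln (real d))) \<longlonglongrightarrow> c"
proof -
  have "(\<lambda>d. real d * ln 4 / (real d * ln (real d))) \<longlonglongrightarrow> 0"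
    "(\<lambda>d. real d * ln (real d + 1) / (real d * ln (real d))) \<longlonglongrightarrow> 1"
    by real_asymp+
  then have "(\<lambda>d. real d * ln 4 / (real d * ln (real d))
      + c * (real d * ln (real d + 1) / (real d * ln (real d)))) \<longlonglongrightarrow> 0 + c * 1"
    by (intro tendsto_intros)
  moreover have "(real d * ln 4 + c * real d * ln (real d + 1)) / (real d * ln (real d))
      = real d * ln 4 / (real d * ln (real d))
        + c * (real d * ln (real d + 1) / (real d * ln (real d)))" for d
    by (simp only: add_divide_distrib mult.assoc times_divide_eq_right)
  ultimately show ?thesis
    by (simp only: mult_1_right add_0_left)
qed

lemma lower_rate_tendsto:
  assumes "0 < m"
  shows "(\<lambda>q. (real (m - 1) * (real q * ln (real q) - real q)) / (real (m * q) * ln (real (m * q))))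
    \<longlonglongrightarrow> real (m - 1) / real m"
proof -
  define l where "l = ln (real m)"
  have "(\<lambda>q. (ln (real q) - 1) / (l + ln (real q))) \<longlonglongrightarrow> 1"
    by real_asymp
  then have "(\<lambda>q. real (m - 1) / real m * ((ln (real q) - 1) / (l + ln (real q))))
      \<longlonglongrightarrow> real (m - 1) / real m * 1"
    by (intro tendsto_intros)
  moreover have "eventually (\<lambda>q. real (m - 1) / real m * ((ln (real q) - 1) / (l + ln (real q)))
      = (real (m - 1) * (real q * ln (real q) - real q)) / (real (m * q) * ln (real (m * q)))) sequentially"
    using eventually_gt_at_top[of 0]
  proof eventually_elim
    case (elim q)
    have "real (m - 1) * (real q * ln (real q) - real q) = real q * (real (m - 1) * (ln (real q) - 1))"
      by (simp add: algebra_simps)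
    moreover have "real (m * q) * ln (real (m * q)) = real q * (real m * (l + ln (real q)))"
      using elim assms by (simp add: l_def ln_mult algebra_simps)
    moreover have "real q \<noteq> 0"
      using elim by simp
    ultimately show ?case
      by (simp only: times_divide_times_eq nonzero_mult_divide_mult_cancel_left not_False_eq_True)
  qed
  ultimately show ?thesis
    by (auto dest: Lim_transform_eventually)
qed


section \<open>The group algebra elements of \<open>I_group\<close>\<close>

lemma group_elt_eq_iff [simp]: "group_elt g = group_elt h \<longleftrightarrow> g = h"
  unfolding group_elt_def by (metis zero_neq_one)

lemma group_elt_neq_zero [simp]: "group_elt g \<noteq> \<zero>\<^bsub>group_algebra G\<^esub>"
  by (auto simp: group_elt_def group_algebra_def fun_eq_iff)

lemma one_group_algebra: "\<one>\<^bsub>group_algebra G\<^esub> = group_elt \<one>\<^bsub>G\<^esub>"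
  by (auto simp: group_elt_def group_algebra_def fun_eq_iff)

lemma I_group_cases:
  assumes "s \<in> I_group G"
  obtains "s = \<zero>\<^bsub>group_algebra G\<^esub>" | g where "g \<in> carrier G" "s = group_elt g"
  using assms by (auto simp: I_group_def)

lemma I_group_subset_carrier: "I_group G \<subseteq> carrier (group_algebra G)"
  by (auto simp: I_group_def group_algebra_def group_elt_def split: if_splits)

lemma finite_I_group: "finite (carrier G) \<Longrightarrow> finite (I_group G)"
  by (simp add: I_group_def)

lemma group_elt_in_I_group: "g \<in> carrier G \<Longrightarrow> group_elt g \<in> I_group G"
  by (simp add: I_group_def)

lemma zero_in_I_group: "\<zero>\<^bsub>group_algebra G\<^esub> \<in> I_group G"
  by (simp add: I_group_def)

lemma linear_maps_zero:
  assumes "\<phi> \<in> linear_maps G d"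
  shows "\<phi> \<zero>\<^bsub>group_algebra G\<^esub> = 0\<^sub>m d d"
proof -
  have z: "\<zero>\<^bsub>group_algebra G\<^esub> \<in> carrier (group_algebra G)"
    using I_group_subset_carrier zero_in_I_group by blast
  have "\<zero>\<^bsub>group_algebra G\<^esub> = 0 \<odot>\<^bsub>group_algebra G\<^esub> \<zero>\<^bsub>group_algebra G\<^esub>"
    by (simp add: group_algebra_def)
  then have "\<phi> \<zero>\<^bsub>group_algebra G\<^esub> = 0 \<cdot>\<^sub>m \<phi> \<zero>\<^bsub>group_algebra G\<^esub>"
    using assms z unfolding linear_maps_def by (metis (mono_tags, lifting) mem_Collect_eq)
  moreover have "\<phi> \<zero>\<^bsub>group_algebra G\<^esub> \<in> carrier_mat d d"
    using assms z by (auto simp: linear_maps_def)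
  then have "0 \<cdot>\<^sub>m \<phi> \<zero>\<^bsub>group_algebra G\<^esub> = 0\<^sub>m d d"
    by (intro eq_matI) auto
  ultimately show ?thesis by simp
qed

context group
begin

lemma I_group_mult_closed:
  "s \<in> I_group G \<Longrightarrow> t \<in> I_group G \<Longrightarrow> s \<otimes>\<^bsub>group_algebra G\<^esub> t \<in> I_group G"
  by (elim I_group_cases) (simp_all add: ga_mult_zero zero_in_I_group
      ga_mult_group_elt[OF is_group] group_elt_in_I_group)

lemma I_group_star_closed: "s \<in> I_group G \<Longrightarrow> ga_star G s \<in> I_group G"
  by (elim I_group_cases) (simp_all add: ga_star_zero zero_in_I_group
      ga_star_group_elt[OF is_group] group_elt_in_I_group)

lemma I_group_mult_one: "s \<in> I_group G \<Longrightarrow> s \<otimes>\<^bsub>group_algebra G\<^esub> \<one>\<^bsub>group_algebra G\<^esub> = s"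
  by (elim I_group_cases) (simp_all add: ga_mult_zero one_group_algebra ga_mult_group_elt[OF is_group])

lemma ga_prod_in_I_group: "set ss \<subseteq> I_group G \<Longrightarrow> ga_prod G ss \<in> I_group G"
  by (induction ss)
    (simp_all add: ga_prod_def one_group_algebra group_elt_in_I_group I_group_mult_closed)

lemma I_group_powers_upto:
  assumes "s \<in> I_group G" "s \<in> \<Omega>" "1 \<le> n"
  shows "s \<in> powers_upto G \<Omega> n"
proof -
  have "ga_prod G [s] = s"
    using I_group_mult_one[OF assms(1)] by (simp add: ga_prod_def)
  then show ?thesis
    using assms(2,3) unfolding powers_upto_def
    by (intro UN_I[of 1] CollectI exI[of _ "[s]"]) auto
qed

lemma powers_upto_subset_I_group:
  "\<Omega> \<subseteq> I_group G \<Longrightarrow> powers_upto G \<Omega> n \<subseteq> I_group G"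
  unfolding powers_upto_def using ga_prod_in_I_group by blast

lemma I_group_union_star: "F \<subseteq> I_group G \<Longrightarrow> F \<union> ga_star G ` F \<subseteq> I_group G"
  using I_group_star_closed by auto


section \<open>The upper bound\<close>

text \<open>The constant \<open>m * m + m + 1\<close> bounds the number of conditions in \<open>defects\<close>: \<open>m * m\<close> products, the
  identity, and at most \<open>m\<close> fixed point conditions. Each of them fails at no more than \<open>\<delta> * d\<close>
  points, the products because of the norm bound (with \<open>\<delta>\<^sup>2 \<le> \<delta>\<close>), the others because of the
  trace bound.\<close>
lemma almost_action_of_SA:
  assumes fin: "finite (carrier G)" and d: "d > 0" and \<delta>: "0 < \<delta>" "\<delta> \<le> 1"
    and \<phi>: "\<phi> \<in> SA G (I_group G) 2 \<delta> d"
  defines "m \<equiv> card (carrier G)"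
  shows "\<exists>a \<in> almost_actions G d (nat \<lfloor>(real (m * m + m + 1)) * \<delta> * real d\<rfloor>).
    \<forall>g\<in>carrier G. \<phi> (group_elt g) = map_mat d (a g)"
proof -
  have \<Omega>: "I_group G \<union> ga_star G ` I_group G = I_group G"
    using I_group_union_star[of "I_group G"] by blast
  have mult: "\<And>k ss. k \<in> {1..2} \<Longrightarrow> length ss = k \<Longrightarrow> set ss \<subseteq> I_group G \<Longrightarrow>
        norm2 (\<phi> (ga_prod G ss) - mat_list_prod d (map \<phi> ss)) < \<delta>"
    and perm: "\<phi> ` powers_upto G (I_group G) 2 \<subseteq> partial_perm_mats d"
    and trace: "\<And>s. s \<in> powers_upto G (I_group G) 2 \<Longrightarrow>
        cmod (norm_trace (\<phi> s) - ga_trace G s) < \<delta>"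
    using \<phi> unfolding SA_def Let_def \<Omega> by auto
  have pw: "group_elt g \<in> powers_upto G (I_group G) 2" if "g \<in> carrier G" for g
    using that by (intro I_group_powers_upto) (auto simp: group_elt_in_I_group)
  have "\<exists>c\<in>null_maps d. \<phi> (group_elt g) = map_mat d c" if "g \<in> carrier G" for g
    using perm pw[OF that] by (intro partial_perm_mat_is_map_mat) auto
  then obtain a0 where a0:
    "\<And>g. g \<in> carrier G \<Longrightarrow> a0 g \<in> null_maps d \<and> \<phi> (group_elt g) = map_mat d (a0 g)"
    by metis
  define a where "a = restrict a0 (carrier G)"
  have a: "a g \<in> null_maps d" "\<phi> (group_elt g) = map_mat d (a g)" if "g \<in> carrier G" for g
    using a0[OF that] that by (simp_all add: a_def)
  have small: "real (card {j. j < d \<and> a g (a h j) \<noteq> a (g \<otimes> h) j}) \<le> \<delta> * real d"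
    if gh: "g \<in> carrier G" "h \<in> carrier G" for g h
  proof -
    have "ga_prod G [group_elt g, group_elt h] = group_elt (g \<otimes> h)"
      using gh by (simp add: ga_prod_def one_group_algebra ga_mult_group_elt[OF is_group])
    moreover have "mat_list_prod d (map \<phi> [group_elt g, group_elt h]) = map_mat d (a g \<circ> a h)"
      using gh a by (simp add: mat_list_prod_def map_mat_mult right_mult_one_mat[OF map_mat_carrier])
    ultimately have "norm2 (map_mat d (a (g \<otimes> h)) - map_mat d (a g \<circ> a h)) < \<delta>"
      using mult[of 2 "[group_elt g, group_elt h]"] gh a(2)[of "g \<otimes> h"]
      by (simp add: group_elt_in_I_group)
    then have "real (card {j. j < d \<and> a (g \<otimes> h) j \<noteq> (a g \<circ> a h) j}) \<le> \<delta>\<^sup>2 * real d"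
      using gh by (intro card_disagreement_le_norm2 a null_maps_comp m_closed)
    also have "\<delta>\<^sup>2 * real d \<le> \<delta> * real d"
      using \<delta> by (intro mult_right_mono) (auto simp: power2_eq_square mult_left_le)
    finally show ?thesis
      by (simp add: eq_commute)
  qed
  have trace': "\<bar>real (card {j. j < d \<and> a g j = j}) / real d - (if g = \<one> then 1 else 0)\<bar> < \<delta>"
    if "g \<in> carrier G" for g
  proof -
    have "norm_trace (\<phi> (group_elt g)) - ga_trace G (group_elt g)
      = of_real (real (card {j. j < d \<and> a g j = j}) / real d - (if g = \<one> then 1 else 0))"
      using that by (simp add: a(2) norm_trace_map_mat ga_trace_group_elt)
    then show ?thesis
      using trace[OF pw[OF that]] by (simp only: norm_of_real)
  qed
  have unit: "real (card {j. j < d \<and> a \<one> j \<noteq> j}) \<le> \<delta> * real d"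
  proof -
    have "card {j. j < d \<and> a \<one> j = j} + card {j. j < d \<and> a \<one> j \<noteq> j} = card {..<d}"
    proof -
      have "{..<d} = {j. j < d \<and> a \<one> j = j} \<union> {j. j < d \<and> a \<one> j \<noteq> j}"
        by auto
      then show ?thesis
        by (subst card_Un_disjoint[symmetric]) auto
    qed
    then have "real (card {j. j < d \<and> a \<one> j \<noteq> j}) = real d - real (card {j. j < d \<and> a \<one> j = j})"
      by (simp flip: of_nat_add)
    moreover have "1 - \<delta> \<le> real (card {j. j < d \<and> a \<one> j = j}) / real d"
      using trace'[OF one_closed] by simp
    then have "(1 - \<delta>) * real d \<le> real (card {j. j < d \<and> a \<one> j = j})"
      using d by (simp add: pos_le_divide_eq)
    ultimately show ?thesis
      by (simp add: algebra_simps)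
  qed
  have fixed: "real (card {j. j < d \<and> a g j = j}) \<le> \<delta> * real d" if "g \<in> carrier G - {\<one>}" for g
  proof -
    have "real (card {j. j < d \<and> a g j = j}) / real d \<le> \<delta>"
      using trace'[of g] that by simp
    then show ?thesis
      using d by (simp add: pos_divide_le_eq)
  qed
  define x where "x = \<delta> * real d"
  have x: "x \<ge> 0" using \<delta> by (simp add: x_def)
  have "real (card (\<Union>(g, h)\<in>carrier G \<times> carrier G. {j. j < d \<and> a g (a h j) \<noteq> a (g \<otimes> h) j}))
      \<le> real (m * m) * x"
    using card_UN_le_real[of "carrier G \<times> carrier G"
        "\<lambda>(g, h). {j. j < d \<and> a g (a h j) \<noteq> a (g \<otimes> h) j}" x] fin small
    by (auto simp: card_cartesian_product m_def x_def)
  moreover have "real (card (\<Union>g\<in>carrier G - {\<one>}. {j. j < d \<and> a g j = j})) \<le> real m * x"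
  proof -
    have "real (card (\<Union>g\<in>carrier G - {\<one>}. {j. j < d \<and> a g j = j}))
        \<le> real (card (carrier G - {\<one>})) * x"
      using fin fixed by (intro card_UN_le_real) (auto simp: x_def)
    also have "\<dots> \<le> real m * x"
      using fin x by (intro mult_right_mono) (auto simp: m_def intro: card_mono)
    finally show ?thesis .
  qed
  moreover have "card (defects G d a) \<le>
      card (\<Union>(g, h)\<in>carrier G \<times> carrier G. {j. j < d \<and> a g (a h j) \<noteq> a (g \<otimes> h) j}) +
      card {j. j < d \<and> a \<one> j \<noteq> j} +
      card (\<Union>g\<in>carrier G - {\<one>}. {j. j < d \<and> a g j = j})"
    unfolding defects_def by (intro order.trans[OF card_Un_le] add_mono card_Un_le order_refl)
  ultimately have "real (card (defects G d a)) \<le> real (m * m) * x + x + real m * x"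
    using unit unfolding x_def by linarith
  also have "\<dots> = real (m * m + m + 1) * \<delta> * real d"
    by (simp add: x_def algebra_simps)
  finally have "card (defects G d a) \<le> nat \<lfloor>real (m * m + m + 1) * \<delta> * real d\<rfloor>"
    by (simp add: le_nat_floor)
  moreover have "a \<in> carrier G \<rightarrow>\<^sub>E null_maps d"
    using a0 by (auto simp: a_def)
  ultimately show ?thesis
    using a(2) by (intro bexI[of _ a]) (auto simp: almost_actions_def)
qed

text \<open>On \<open>I_group G\<close> a linear map is determined by its values at the group elements, so its
  restriction can be decoded (by \<open>\<Psi>\<close>) from the associated almost action.\<close>
lemma card_restrict_SA_le:
  assumes fin: "finite (carrier G)" and d: "d > 0" and \<delta>: "0 < \<delta>" "\<delta> \<le> 1"
    and E: "E \<subseteq> I_group G"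
  defines "m \<equiv> card (carrier G)"
  defines "Act \<equiv> almost_actions G d (nat \<lfloor>real (m * m + m + 1) * \<delta> * real d\<rfloor>)"
  shows "finite ((\<lambda>\<phi>. restrict \<phi> E) ` SA G (I_group G) 2 \<delta> d)"
    and "card ((\<lambda>\<phi>. restrict \<phi> E) ` SA G (I_group G) 2 \<delta> d) \<le> card Act"
proof -
  define \<Psi> where "\<Psi> a = (\<lambda>s\<in>E. if s = \<zero>\<^bsub>group_algebra G\<^esub> then 0\<^sub>m d d
    else map_mat d (a (THE g. s = group_elt g)))" for a :: "'a \<Rightarrow> nat \<Rightarrow> nat"
  have "(\<lambda>\<phi>. restrict \<phi> E) ` SA G (I_group G) 2 \<delta> d \<subseteq> \<Psi> ` Act"
  proof
    fix f assume "f \<in> (\<lambda>\<phi>. restrict \<phi> E) ` SA G (I_group G) 2 \<delta> d"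
    then obtain \<phi> where \<phi>: "\<phi> \<in> SA G (I_group G) 2 \<delta> d" and f: "f = restrict \<phi> E"
      by blast
    obtain a where a: "a \<in> Act" "\<forall>g\<in>carrier G. \<phi> (group_elt g) = map_mat d (a g)"
      using almost_action_of_SA[OF fin d \<delta> \<phi>] unfolding Act_def m_def by blast
    have "\<phi> \<zero>\<^bsub>group_algebra G\<^esub> = 0\<^sub>m d d"
      using \<phi> by (intro linear_maps_zero) (simp add: SA_def Let_def)
    then have "\<phi> s = \<Psi> a s" if "s \<in> E" for s
    proof -
      have "s \<in> I_group G" using that E by blast
      then show ?thesis
        by (cases rule: I_group_cases) (use that a \<open>\<phi> _ = 0\<^sub>m d d\<close> in \<open>simp_all add: \<Psi>_def\<close>)
    qed
    then have "f = \<Psi> a"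
      unfolding f by (intro ext) (simp add: restrict_def \<Psi>_def)
    then show "f \<in> \<Psi> ` Act" using a(1) by blast
  qed
  moreover have "finite Act"
    unfolding Act_def by (rule finite_almost_actions[OF fin])
  ultimately show "finite ((\<lambda>\<phi>. restrict \<phi> E) ` SA G (I_group G) 2 \<delta> d)"
    and "card ((\<lambda>\<phi>. restrict \<phi> E) ` SA G (I_group G) 2 \<delta> d) \<le> card Act"
    by (blast intro: finite_subset, intro surj_card_le)
qed

lemma sofic_dim_at_le:
  assumes fin: "finite (carrier G)" and \<delta>: "0 < \<delta>" "\<delta> \<le> 1" and E: "E \<subseteq> I_group G"
  defines "m \<equiv> card (carrier G)"
  shows "sofic_dim_at G E (I_group G) 2 \<delta>
    \<le> ereal (1 - 1 / real m + real (m * (m * m + m + 1)) * \<delta>)"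
proof -
  define c where "c = 1 - 1 / real m + real (m * (m * m + m + 1)) * \<delta>"
  have m: "m > 0"
    unfolding m_def using fin one_closed by (auto simp: card_gt_0_iff)
  have "log_card ((\<lambda>\<phi>. restrict \<phi> E) ` SA G (I_group G) 2 \<delta> d) / ereal (real d * ln (real d))
      \<le> ereal ((real d * ln 4 + c * real d * ln (real d + 1)) / (real d * ln (real d)))"
    if d: "d \<ge> 2" for d
  proof -
    define b where "b = nat \<lfloor>real (m * m + m + 1) * \<delta> * real d\<rfloor>"
    define N where "N = (m - 1) * (d div m) + m * b"
    have d0: "d > 0" using d by simp
    have N_le: "real N \<le> c * real d"
    proof -
      have "real (d div m) \<le> real d / real m"
        by (rule of_nat_div_le_of_nat)
      then have "real (m - 1) * real (d div m) \<le> real (m - 1) * (real d / real m)"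
        by (intro mult_left_mono) auto
      also have "\<dots> = (1 - 1 / real m) * real d"
        using m by (simp add: of_nat_diff field_simps)
      finally have "real (m - 1) * real (d div m) \<le> (1 - 1 / real m) * real d" .
      moreover have "real b \<le> real (m * m + m + 1) * \<delta> * real d"
        unfolding b_def using \<delta> by (intro of_nat_floor) auto
      then have "real m * real b \<le> real m * (real (m * m + m + 1) * \<delta> * real d)"
        by (intro mult_left_mono) auto
      moreover have "real N = real (m - 1) * real (d div m) + real m * real b"
        by (simp add: N_def)
      moreover have "c * real d
          = (1 - 1 / real m) * real d + real m * (real (m * m + m + 1) * \<delta> * real d)"
        unfolding c_def by (simp only: distrib_right of_nat_mult mult.assoc)
      ultimately show ?thesis by linarith
    qed
    have "log_card ((\<lambda>\<phi>. restrict \<phi> E) ` SA G (I_group G) 2 \<delta> d)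
        \<le> ereal (ln (real (4 ^ d * (d + 1) ^ N)))"
      using card_restrict_SA_le[OF fin d0 \<delta> E] card_almost_actions_le[OF fin, of d b]
      unfolding N_def b_def m_def by (intro log_card_le) (auto intro: order.trans)
    also have "ln (real (4 ^ d * (d + 1) ^ N)) = real d * ln 4 + real N * ln (real d + 1)"
      by (simp add: ln_mult ln_realpow add.commute)
    also have "ereal (real d * ln 4 + real N * ln (real d + 1))
        \<le> ereal (real d * ln 4 + c * real d * ln (real d + 1))"
      using N_le by (subst ereal_less_eq) (intro add_left_mono mult_right_mono, auto)
    finally have "log_card ((\<lambda>\<phi>. restrict \<phi> E) ` SA G (I_group G) 2 \<delta> d)
        \<le> ereal (real d * ln 4 + c * real d * ln (real d + 1))" .
    then have "log_card ((\<lambda>\<phi>. restrict \<phi> E) ` SA G (I_group G) 2 \<delta> d) / ereal (real d * ln (real d))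
        \<le> ereal (real d * ln 4 + c * real d * ln (real d + 1)) / ereal (real d * ln (real d))"
      using d by (intro ereal_divide_right_mono) auto
    then show ?thesis
      using d by simp
  qed
  then have "sofic_dim_at G E (I_group G) 2 \<delta>
      \<le> limsup (\<lambda>d. ereal ((real d * ln 4 + c * real d * ln (real d + 1)) / (real d * ln (real d))))"
    unfolding sofic_dim_at_def by (intro Limsup_mono eventually_sequentiallyI[of 2]) auto
  also have "\<dots> = ereal c"
    using upper_rate_tendsto by (intro lim_imp_Limsup) auto
  finally show ?thesis by (simp add: c_def)
qed

lemma sofic_dimension_le:
  assumes fin: "finite (carrier G)"
  shows "sofic_dimension G \<le> ereal (1 - 1 / real (card (carrier G)))"
  unfolding sofic_dimension_def
proof (rule SUP_least)
  fix E assume "E \<in> {E. finite E \<and> E \<subseteq> I_group G}"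
  then have E: "E \<subseteq> I_group G" by simp
  define m where "m = card (carrier G)"
  define K where "K = real (m * (m * m + m + 1))"
  have m: "m > 0"
    unfolding m_def using fin one_closed by (auto simp: card_gt_0_iff)
  then have K: "K > 0"
    unfolding K_def by (intro of_nat_0_less_iff[THEN iffD2]) simp
  have "(INF F\<in>{F. finite F \<and> F \<subseteq> I_group G}. sofic_dim_wrt G E F)
      \<le> ereal (1 - 1 / real m) + ereal e" if e: "e > 0" for e
  proof -
    \<comment> \<open>\<open>K\<close> is the rate at which the defects raise the bound in \<open>\<delta>\<close>, so this choice costs at most \<open>e\<close>.\<close>
    define \<delta> where "\<delta> = min 1 (e / K)"
    have \<delta>: "0 < \<delta>" "\<delta> \<le> 1"
      using e K by (auto simp: \<delta>_def)
    have "K * \<delta> \<le> K * (e / K)"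
      using K by (intro mult_left_mono) (auto simp: \<delta>_def)
    then have Ke: "K * \<delta> \<le> e"
      using K by simp
    have "(INF F\<in>{F. finite F \<and> F \<subseteq> I_group G}. sofic_dim_wrt G E F) \<le> sofic_dim_wrt G E (I_group G)"
      using finite_I_group[OF fin] by (intro INF_lower) auto
    also have "\<dots> \<le> (INF \<delta>\<in>{0<..}. sofic_dim_at G E (I_group G) 2 \<delta>)"
      unfolding sofic_dim_wrt_def by (intro INF_lower) auto
    also have "\<dots> \<le> sofic_dim_at G E (I_group G) 2 \<delta>"
      using \<delta> by (intro INF_lower) auto
    also have "\<dots> \<le> ereal (1 - 1 / real m + K * \<delta>)"
      using sofic_dim_at_le[OF fin \<delta> E] by (simp add: m_def K_def)
    also have "\<dots> \<le> ereal (1 - 1 / real m) + ereal e"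
      using Ke by simp
    finally show ?thesis .
  qed
  then show "(INF F\<in>{F. finite F \<and> F \<subseteq> I_group G}. sofic_dim_wrt G E F)
      \<le> ereal (1 - 1 / real (card (carrier G)))"
    unfolding m_def by (rule ereal_le_epsilon2)
qed


section \<open>The lower bound\<close>

text \<open>The linear extension of \<open>g \<mapsto> map_mat d (a g)\<close>.\<close>
definition permutation_rep :: "nat \<Rightarrow> ('a \<Rightarrow> nat \<Rightarrow> nat) \<Rightarrow> ('a \<Rightarrow> complex) \<Rightarrow> complex mat" where
  "permutation_rep d a = (\<lambda>f\<in>carrier (group_algebra G).
     mat d d (\<lambda>(i, j). \<Sum>g\<in>carrier G. if a g j = i then f g else 0))"

lemma permutation_rep_linear: "permutation_rep d a \<in> linear_maps G d"
proof -
  have carr: "(\<lambda>x. f x + g x) \<in> carrier (group_algebra G)"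
    if "f \<in> carrier (group_algebra G)" "g \<in> carrier (group_algebra G)" for f g
  proof -
    have "{x. f x + g x \<noteq> 0} \<subseteq> {x. f x \<noteq> 0} \<union> {x. g x \<noteq> 0}" by auto
    then show ?thesis
      using that by (auto simp: group_algebra_def intro: finite_subset)
  qed
  have smult: "(\<lambda>x. c * f x) \<in> carrier (group_algebra G)"
    if "f \<in> carrier (group_algebra G)" for f c
  proof -
    have "{x. c * f x \<noteq> 0} \<subseteq> {x. f x \<noteq> 0}" by auto
    then show ?thesis
      using that by (auto simp: group_algebra_def intro: finite_subset)
  qed
  have add_eq: "f \<oplus>\<^bsub>group_algebra G\<^esub> g = (\<lambda>x. f x + g x)" for f g
    by (simp add: group_algebra_def)
  have smult_eq: "c \<odot>\<^bsub>group_algebra G\<^esub> f = (\<lambda>x. c * f x)" for c f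
    by (simp add: group_algebra_def)
  show ?thesis
    unfolding linear_maps_def add_eq smult_eq
  proof (intro CollectI conjI ballI allI)
    show "permutation_rep d a \<in> carrier (group_algebra G) \<rightarrow>\<^sub>E carrier_mat d d"
      by (simp add: permutation_rep_def)
    fix f g assume "f \<in> carrier (group_algebra G)" "g \<in> carrier (group_algebra G)"
    moreover have "(\<Sum>h\<in>carrier G. if a h j = i then f h + g h else 0)
        = (\<Sum>h\<in>carrier G. if a h j = i then f h else 0) + (\<Sum>h\<in>carrier G. if a h j = i then g h else 0)"
      for i j
      by (subst sum.distrib[symmetric]) (intro sum.cong, auto)
    ultimately show "permutation_rep d a (\<lambda>x. f x + g x) = permutation_rep d a f + permutation_rep d a g"
      using carr[of f g] by (intro eq_matI) (simp_all add: permutation_rep_def)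
  next
    fix c f assume "f \<in> carrier (group_algebra G)"
    moreover have "(\<Sum>h\<in>carrier G. if a h j = i then c * f h else 0)
        = c * (\<Sum>h\<in>carrier G. if a h j = i then f h else 0)" for i j
      by (subst sum_distrib_left) (intro sum.cong, auto)
    ultimately show "permutation_rep d a (\<lambda>x. c * f x) = c \<cdot>\<^sub>m permutation_rep d a f"
      using smult[of f c] by (intro eq_matI) (simp_all add: permutation_rep_def)
  qed
qed

lemma permutation_rep_group_elt:
  assumes "finite (carrier G)" "g \<in> carrier G"
  shows "permutation_rep d a (group_elt g) = map_mat d (a g)"
proof -
  have "group_elt g \<in> carrier (group_algebra G)"
    using group_elt_in_I_group[OF assms(2)] I_group_subset_carrier by blast
  moreover have "(\<Sum>h\<in>carrier G. if a h j = i then group_elt g h else 0)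
      = (if a g j = i then 1 else 0)" for i j
  proof -
    have "(\<Sum>h\<in>carrier G. if a h j = i then group_elt g h else 0)
        = (\<Sum>h\<in>carrier G. if h = g then (if a g j = i then 1 else 0) else 0)"
      by (intro sum.cong) (auto simp: group_elt_def)
    then show ?thesis using assms by (simp add: sum.delta)
  qed
  ultimately show ?thesis
    by (simp add: permutation_rep_def map_mat_def)
qed

text \<open>Without defects the action law holds at every point: at the null point, and beyond it, both
  sides are null.\<close>
lemma free_action:
  assumes "a \<in> almost_actions G d 0"
  shows "\<And>g. g \<in> carrier G \<Longrightarrow> a g \<in> null_maps d"
    and "\<And>g h. g \<in> carrier G \<Longrightarrow> h \<in> carrier G \<Longrightarrow> a g \<circ> a h = a (g \<otimes> h)"
    and "\<And>j. j < d \<Longrightarrow> a \<one> j = j"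
    and "\<And>g j. g \<in> carrier G \<Longrightarrow> j < d \<Longrightarrow> a g j = j \<Longrightarrow> g = \<one>"
proof -
  have D: "defects G d a = {}"
    using assms by (simp add: almost_actions_def)
  show null: "a g \<in> null_maps d" if "g \<in> carrier G" for g
    using assms that by (auto simp: almost_actions_def)
  show "a g \<circ> a h = a (g \<otimes> h)" if gh: "g \<in> carrier G" "h \<in> carrier G" for g h
  proof
    fix j
    show "(a g \<circ> a h) j = a (g \<otimes> h) j"
    proof (cases "j < d")
      case True
      then show ?thesis
        using regular_point(1)[of j d a g h] D gh by simp
    next
      case False
      then show ?thesis
        using null_maps_null[OF null[OF gh(1)]] null_maps_null[OF null[OF gh(2)]]
          null_maps_null[OF null[OF m_closed[OF gh]]] by simp
    qed
  qed
  show "a \<one> j = j" if "j < d" for j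
    using regular_point(2)[of j d a] D that by simp
  show "g = \<one>" if "g \<in> carrier G" "j < d" "a g j = j" for g j
    using regular_point(3)[of j d a g] D that by simp
qed

lemma permutation_rep_mult:
  assumes fin: "finite (carrier G)" and a: "a \<in> almost_actions G d 0"
    and st: "s \<in> I_group G" "t \<in> I_group G"
  shows "permutation_rep d a (s \<otimes>\<^bsub>group_algebra G\<^esub> t) = permutation_rep d a s * permutation_rep d a t"
proof -
  note zero = linear_maps_zero[OF permutation_rep_linear[of d a]]
  note elt = permutation_rep_group_elt[OF fin]
  have carr: "permutation_rep d a s \<in> carrier_mat d d" if "s \<in> I_group G" for s
    using that by (cases rule: I_group_cases) (simp_all add: zero elt)
  show ?thesis
    using st(1)
  proof (cases rule: I_group_cases)
    case 1
    then show ?thesis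
      using carr[OF st(2)] by (simp add: ga_mult_zero zero)
  next
    case (2 g)
    note g = this
    show ?thesis
      using st(2)
    proof (cases rule: I_group_cases)
      case 1
      then show ?thesis
        using carr[OF st(1)] by (simp add: ga_mult_zero zero)
    next
      case (2 h)
      then show ?thesis
        using g by (simp add: ga_mult_group_elt[OF is_group] elt map_mat_mult free_action[OF a])
    qed
  qed
qed

lemma permutation_rep_ga_prod:
  assumes fin: "finite (carrier G)" and a: "a \<in> almost_actions G d 0"
    and ss: "set ss \<subseteq> I_group G"
  shows "permutation_rep d a (ga_prod G ss) = mat_list_prod d (map (permutation_rep d a) ss)"
  using ss
proof (induction ss)
  case Nil
  have "map_mat d (a \<one>) = 1\<^sub>m d"
    by (intro eq_matI) (auto simp: free_action(3)[OF a])
  then show ?case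
    by (simp add: ga_prod_def mat_list_prod_def one_group_algebra permutation_rep_group_elt[OF fin])
next
  case (Cons s ss)
  then show ?case
    using permutation_rep_mult[OF fin a, of s "ga_prod G ss"] ga_prod_in_I_group[of ss]
    by (simp add: ga_prod_def mat_list_prod_def)
qed

text \<open>A free action gives an exact homomorphism by permutation matrices, and its trace is
  exactly \<open>ga_trace G\<close> on \<open>I_group G\<close> because non-identity elements have no fixed points.\<close>
lemma permutation_rep_in_SA:
  assumes fin: "finite (carrier G)" and a: "a \<in> almost_actions G d 0" and d: "d > 0"
    and F: "F \<subseteq> I_group G" and \<delta>: "\<delta> > 0"
  shows "permutation_rep d a \<in> SA G F n \<delta> d"
proof -
  note zero = linear_maps_zero[OF permutation_rep_linear[of d a]]
  note elt = permutation_rep_group_elt[OF fin]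
  define \<Omega> where "\<Omega> = F \<union> ga_star G ` F"
  have \<Omega>: "\<Omega> \<subseteq> I_group G"
    unfolding \<Omega>_def by (rule I_group_union_star[OF F])
  have pI: "powers_upto G \<Omega> n \<subseteq> I_group G"
    by (rule powers_upto_subset_I_group[OF \<Omega>])
  have carr: "permutation_rep d a s \<in> carrier_mat d d" if "s \<in> I_group G" for s
    using that by (cases rule: I_group_cases) (simp_all add: zero elt)
  have "norm2 (permutation_rep d a (ga_prod G ss) - mat_list_prod d (map (permutation_rep d a) ss)) < \<delta>"
    if "set ss \<subseteq> \<Omega>" for ss
  proof -
    have ss: "set ss \<subseteq> I_group G" using that \<Omega> by blast
    have "norm2 (0\<^sub>m d d) = 0"
      by (subst norm2_eq_sum[of _ d]) auto
    moreover have "mat_list_prod d (map (permutation_rep d a) ss) \<in> carrier_mat d d"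
      using carr[OF ga_prod_in_I_group[OF ss]] by (simp add: permutation_rep_ga_prod[OF fin a ss])
    ultimately show ?thesis
      using \<delta> by (simp add: permutation_rep_ga_prod[OF fin a ss])
  qed
  moreover have "permutation_rep d a s \<in> partial_perm_mats d" if "s \<in> I_group G" for s
    using that
  proof (cases rule: I_group_cases)
    case 1
    have "0\<^sub>m d d = map_mat d (\<lambda>_. d)"
      by (intro eq_matI) auto
    moreover have "map_mat d (\<lambda>_. d) \<in> partial_perm_mats d"
      by (rule map_mat_partial_perm[of _ _ "\<lambda>_. d"]) (auto simp: null_maps_def)
    ultimately show ?thesis
      using 1 by (simp add: zero)
  next
    case (2 g)
    have inv_pt: "a (inv h) (a h j) = j" if "h \<in> carrier G" "j < d" for h j
      using fun_cong[OF free_action(2)[OF a, of "inv h" h], of j] free_action(3)[OF a] that by simp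
    have "map_mat d (a g) \<in> partial_perm_mats d"
    proof (rule map_mat_partial_perm)
      show "(a g j = i) = (a (inv g) i = j)" if "i < d" "j < d" for i j
      proof
        assume "a g j = i"
        then show "a (inv g) i = j"
          using inv_pt[of g j] 2 that by simp
      next
        assume "a (inv g) i = j"
        then show "a g j = i"
          using inv_pt[of "inv g" i] 2 that by simp
      qed
    qed (use 2 free_action(1)[OF a] in auto)
    then show ?thesis
      using 2 by (simp add: elt)
  qed
  moreover have "norm_trace (permutation_rep d a s) = ga_trace G s" if "s \<in> I_group G" for s
    using that
  proof (cases rule: I_group_cases)
    case 1
    then show ?thesis
      by (simp add: zero ga_trace_zero norm_trace_def)
  next
    case (2 g)
    have "{j. j < d \<and> a g j = j} = (if g = \<one> then {..<d} else {})"
      using free_action(3,4)[OF a] 2 by auto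
    then show ?thesis
      using 2 d by (simp add: elt norm_trace_map_mat ga_trace_group_elt)
  qed
  ultimately show ?thesis
    unfolding SA_def Let_def \<Omega>_def[symmetric]
    using \<delta> pI permutation_rep_linear[of d a] by (auto simp: subset_iff)
qed

text \<open>Distinct free actions have representations that differ already at a group element.\<close>
lemma card_restrict_SA_ge:
  assumes fin: "finite (carrier G)" and d: "d > 0" and F: "F \<subseteq> I_group G" and \<delta>: "\<delta> > 0"
    and finX: "finite ((\<lambda>\<phi>. restrict \<phi> (I_group G)) ` SA G F n \<delta> d)"
  shows "card (almost_actions G d 0) \<le> card ((\<lambda>\<phi>. restrict \<phi> (I_group G)) ` SA G F n \<delta> d)"
proof (rule card_inj_on_le[OF _ _ finX])
  let ?f = "\<lambda>a. restrict (permutation_rep d a) (I_group G)"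
  show "?f ` almost_actions G d 0 \<subseteq> (\<lambda>\<phi>. restrict \<phi> (I_group G)) ` SA G F n \<delta> d"
    using permutation_rep_in_SA[OF fin _ d F \<delta>] by blast
  show "inj_on ?f (almost_actions G d 0)"
  proof (rule inj_onI)
    fix a a' assume a: "a \<in> almost_actions G d 0" "a' \<in> almost_actions G d 0" and eq: "?f a = ?f a'"
    have "a \<in> carrier G \<rightarrow>\<^sub>E null_maps d" "a' \<in> carrier G \<rightarrow>\<^sub>E null_maps d"
      using a by (simp_all add: almost_actions_def)
    then show "a = a'"
    proof (rule PiE_ext)
      fix g assume g: "g \<in> carrier G"
      have "map_mat d (a g) = map_mat d (a' g)"
        using fun_cong[OF eq, of "group_elt g"] g
        by (simp add: group_elt_in_I_group permutation_rep_group_elt[OF fin])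
      then show "a g = a' g"
        using inj_onD[OF inj_on_map_mat] free_action(1)[OF a(1) g] free_action(1)[OF a(2) g] by blast
    qed
  qed
qed

lemma sofic_dim_at_ge:
  assumes fin: "finite (carrier G)" and F: "F \<subseteq> I_group G" and \<delta>: "\<delta> > 0"
  defines "m \<equiv> card (carrier G)"
  shows "ereal (1 - 1 / real m) \<le> sofic_dim_at G (I_group G) F n \<delta>"
proof -
  have m: "m > 0"
    unfolding m_def using fin one_closed by (auto simp: card_gt_0_iff)
  define X where "X d = log_card ((\<lambda>\<phi>. restrict \<phi> (I_group G)) ` SA G F n \<delta> d)
    / ereal (real d * ln (real d))" for d
  define Y where "Y q = real (m - 1) * (real q * ln (real q) - real q)
    / (real (m * q) * ln (real (m * q)))" for q
  have "ereal (Y q) \<le> X (m * q)" if q: "q \<ge> 2" for q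
  proof -
    have mq: "m * q \<ge> 2" using mult_le_mono[of 1 m 2 q] m q by simp
    have "real (m - 1) * (real q * ln (real q) - real q) \<le> real (m - 1) * ln (fact q)"
      by (intro mult_left_mono ln_fact_ge) auto
    also have "\<dots> = ln (real (fact q ^ (m - 1)))"
      by (simp add: ln_realpow)
    finally have "ereal (real (m - 1) * (real q * ln (real q) - real q))
        \<le> ereal (ln (real (fact q ^ (m - 1))))"
      by simp
    also have "\<dots> \<le> log_card ((\<lambda>\<phi>. restrict \<phi> (I_group G)) ` SA G F n \<delta> (m * q))"
    proof (rule log_card_ge)
      assume "finite ((\<lambda>\<phi>. restrict \<phi> (I_group G)) ` SA G F n \<delta> (m * q))"
      then have "card (almost_actions G (m * q) 0)
          \<le> card ((\<lambda>\<phi>. restrict \<phi> (I_group G)) ` SA G F n \<delta> (m * q))"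
        using mq by (intro card_restrict_SA_ge[OF fin _ F \<delta>]) linarith
      with card_free_actions_ge[OF fin, of q, folded m_def]
      show "fact q ^ (m - 1) \<le> card ((\<lambda>\<phi>. restrict \<phi> (I_group G)) ` SA G F n \<delta> (m * q))"
        by (rule order.trans)
    qed simp
    finally have num: "ereal (real (m - 1) * (real q * ln (real q) - real q))
        \<le> log_card ((\<lambda>\<phi>. restrict \<phi> (I_group G)) ` SA G F n \<delta> (m * q))" .
    define x where "x = real (m * q)"
    have "real 1 < x"
      using mq unfolding x_def by (subst of_nat_less_iff) linarith
    then have "x > 1"
      by simp
    then have pos: "x * ln x > 0"
      by simp
    then have "ereal (real (m - 1) * (real q * ln (real q) - real q)) / ereal (x * ln x) \<le> X (m * q)"
      unfolding X_def x_def[symmetric] using num by (intro ereal_divide_right_mono) auto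
    then show ?thesis
      using \<open>x > 1\<close> unfolding Y_def x_def[symmetric] by simp
  qed
  then have "limsup (\<lambda>q. ereal (Y q)) \<le> limsup (X \<circ> (\<lambda>q. m * q))"
    by (intro Limsup_mono eventually_sequentiallyI[of 2]) auto
  also have "\<dots> \<le> limsup X"
    using m by (intro limsup_subseq_mono) (auto simp: strict_mono_def)
  also have "\<dots> = sofic_dim_at G (I_group G) F n \<delta>"
    by (simp add: sofic_dim_at_def X_def[abs_def])
  finally have "limsup (\<lambda>q. ereal (Y q)) \<le> sofic_dim_at G (I_group G) F n \<delta>" .
  moreover have "limsup (\<lambda>q. ereal (Y q)) = ereal (real (m - 1) / real m)"
    using lower_rate_tendsto[OF m] by (intro lim_imp_Limsup) (auto simp: Y_def)
  moreover have "real (m - 1) / real m = 1 - 1 / real m"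
    using m by (simp add: of_nat_diff field_simps)
  ultimately show ?thesis by simp
qed

lemma sofic_dimension_ge:
  assumes fin: "finite (carrier G)"
  shows "ereal (1 - 1 / real (card (carrier G))) \<le> sofic_dimension G"
proof -
  have "ereal (1 - 1 / real (card (carrier G)))
      \<le> (INF F\<in>{F. finite F \<and> F \<subseteq> I_group G}. sofic_dim_wrt G (I_group G) F)"
    unfolding sofic_dim_wrt_def by (intro INF_greatest sofic_dim_at_ge[OF fin]) auto
  also have "\<dots> \<le> sofic_dimension G"
    unfolding sofic_dimension_def using finite_I_group[OF fin] by (intro SUP_upper) auto
  finally show ?thesis .
qed

end

theorem proposition3p5:
  fixes G :: "('a, 'm) monoid_scheme"
  assumes "group G" and "finite (carrier G)"
  shows "sofic_dimension G = ereal (1 - 1 / real (card (carrier G)))"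
  using group.sofic_dimension_le[OF assms] group.sofic_dimension_ge[OF assms] by (rule antisym)

end
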